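(* Let $G$ be a compact abelian group with normalized Haar measure $m_G$ and identity $e$, and let $(\lambda_s)_{s\ge1}$ be probability measures on $G$ such that, for every $s\ge1$, there exists a probability measure $\kappa_s$ on $G$ satisfying \[ \lambda_s=\lambda_{s+1}*\kappa_s . \] Put $\mu_s:=\lambda_s*\check\lambda_s$ and $T_sf:=f*\mu_s$. Then, for every $1<p<\infty$ and every $f\in L^p(G)$, \[ \Bigl\|\sup_{s\ge1}|T_sf|\Bigr\|_{L^p(G)}\le\frac{p}{p-1}\,\|f\|_{L^p(G)} . \] If, in addition, $\mu_s\to\delta_e$ in the weak-* topology as $s\to\infty$, then for every $1<p<\infty$ and every $f\in L^p(G)$, $T_sf\to f$ as $s\to\infty$, both $m_G$-almost everywhere and in $L^p(G)$.
   Context: $L^p(G)=L^p(G,m_G)$. For a probability measure $\mu$ on a compact abelian group $G$ (written multiplicatively), $(f*\mu)(x):=\int_G f(xy^{-1})\,d\mu(y)$, and $\check\mu$ denotes the image of $\mu$ under the inversion map $y\mapsto y^{-1}$. The convolution of two measures $\mu*\nu$ is the image of $\mu\otimes\nu$ under multiplication $G\times G\to G$. Compact groups are Hausdorff and probability measures on $G$ are regular Borel measures. $\delta_e$ is the point mass at $e$, and weak-* convergence $\mu_s\to\delta_e$ means $\int_G h\,d\mu_s\to h(e)$ for every continuous $h:G\to\mathbb C$. *)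

theory Defs
  imports "HOL-Probability.Probability_Measure"
begin

text \<open>
  Abelian groups are written additively, as instances of \<^class>\<open>topological_ab_group_add\<close>:
  the group is the whole type, \<open>e\<close> is \<open>0\<close>, \<open>y\<inverse>\<close> is \<open>- y\<close> and \<open>x y\<inverse>\<close> is \<open>x - y\<close>.
  The topology is not assumed to be second countable.
\<close>

definition regular_borel_prob :: "'a::topological_space measure \<Rightarrow> bool" where
  "regular_borel_prob M \<longleftrightarrow>
     prob_space M \<and> sets M = sets borel \<and>
     (\<forall>A\<in>sets borel. emeasure M A = (SUP K\<in>{K. K \<subseteq> A \<and> compact K}. emeasure M K)) \<and>
     (\<forall>A\<in>sets borel. emeasure M A = (INF U\<in>{U. A \<subseteq> U \<and> open U}. emeasure M U))"

definition normalized_haar :: "'a::topological_ab_group_add measure \<Rightarrow> bool" where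
  "normalized_haar m \<longleftrightarrow> regular_borel_prob m \<and> (\<forall>a. distr m borel (\<lambda>x. a + x) = m)"

text \<open>
  The product of Borel measures as a measure on the Borel sets of the product space.
  The library's \<open>M \<Otimes>\<^sub>M N\<close> has the same defining formula, but lives only on the product
  \<open>\<sigma>\<close>-algebra, which without second countability may be strictly smaller than the
  Borel \<open>\<sigma>\<close>-algebra and may fail to make addition measurable.  For regular factors the formula
  does define a measure, see \<open>emeasure_borel_product\<close> and \<open>emeasure_borel_product_Times\<close> below.
\<close>

definition borel_product ::
  "'a::topological_space measure \<Rightarrow> 'b::topological_space measure \<Rightarrow> ('a \<times> 'b) measure" where
  "borel_product M N =
     measure_of UNIV (sets borel) (\<lambda>E. \<integral>\<^sup>+x. \<integral>\<^sup>+y. indicator E (x, y) \<partial>N \<partial>M)"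

definition measure_conv ::
  "'a::topological_ab_group_add measure \<Rightarrow> 'a measure \<Rightarrow> 'a measure" where
  "measure_conv M N = distr (borel_product M N) borel (\<lambda>(x, y). x + y)"

definition reflected :: "'a::topological_ab_group_add measure \<Rightarrow> 'a measure" where
  "reflected M = distr M borel uminus"

definition fun_conv ::
  "('a::topological_ab_group_add \<Rightarrow> complex) \<Rightarrow> 'a measure \<Rightarrow> 'a \<Rightarrow> complex" where
  "fun_conv f M x = (\<integral>y. f (x - y) \<partial>M)"

definition weak_star_to_delta0 :: "(nat \<Rightarrow> 'a::topological_ab_group_add measure) \<Rightarrow> bool" where
  "weak_star_to_delta0 M \<longleftrightarrow>
     (\<forall>h :: 'a \<Rightarrow> complex. continuous_on UNIV h \<longrightarrow> (\<lambda>s. \<integral>x. h x \<partial>M s) \<longlonglongrightarrow> h 0)"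

text \<open>Powers of extended nonnegative reals, for exponents \<open>a > 0\<close> only.\<close>

definition enn_powr :: "ennreal \<Rightarrow> real \<Rightarrow> ennreal" where
  "enn_powr x a = (if x = \<infinity> then \<infinity> else ennreal (enn2real x powr a))"

text \<open>
  The \<open>L\<^sup>p\<close> norm is taken of \<open>[0,\<infinity>]\<close>-valued functions, so that it applies to suprema that are
  not known to be finite.
\<close>

definition Lp_norm :: "real \<Rightarrow> 'a measure \<Rightarrow> ('a \<Rightarrow> ennreal) \<Rightarrow> ennreal" where
  "Lp_norm p M F = enn_powr (\<integral>\<^sup>+x. enn_powr (F x) p \<partial>M) (1 / p)"

definition Lp_space :: "real \<Rightarrow> 'a measure \<Rightarrow> ('a \<Rightarrow> complex) set" where
  "Lp_space p M =
     {f \<in> borel_measurable M. Lp_norm p M (\<lambda>x. ennreal (norm (f x))) < \<infinity>}"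

lemma borel_measurable_Pair_section:
  fixes E :: "('a::topological_space \<times> 'b::topological_space) set"
  assumes "E \<in> sets borel"
  shows "Pair x -` E \<in> sets borel"
proof -
  have "Pair x \<in> borel_measurable (borel :: 'b measure)"
    by (intro borel_measurable_continuous_onI continuous_intros)
  from measurable_sets[OF this assms] show ?thesis by simp
qed

lemma borel_measurable_emeasure_section:
  fixes E :: "('a::topological_space \<times> 'b::topological_space) set"
  assumes N: "regular_borel_prob N" and E: "E \<in> sets borel"
  shows "(\<lambda>x. emeasure N (Pair x -` E)) \<in> borel_measurable borel"
proof -
  interpret N: prob_space N using N by (simp add: regular_borel_prob_def)
  have sN: "sets N = sets borel" using N by (simp add: regular_borel_prob_def)
  have spN: "space N = UNIV" using sets_eq_imp_space_eq[OF sN] by simp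
  have sec: "Pair x -` A \<in> sets N" if "A \<in> sigma_sets UNIV {S. open S}"
    for A :: "('a \<times> 'b) set" and x
    using borel_measurable_Pair_section[of A x] that by (simp add: sN sets_borel)
  have "Int_stable {S :: ('a \<times> 'b) set. open S}"
    by (auto simp: Int_stable_def)
  moreover have "{S :: ('a \<times> 'b) set. open S} \<subseteq> Pow UNIV" by simp
  moreover have "E \<in> sigma_sets UNIV {S. open S}" using E by (simp add: sets_borel)
  ultimately show ?thesis
  proof (induction E rule: sigma_sets_induct_disjoint)
    case (basic A)
    show ?case
    proof (rule borel_measurableI_greater)
      fix a :: ennreal
      have "\<exists>U. open U \<and> x \<in> U \<and> U \<subseteq> {x. a < emeasure N (Pair x -` A)}"
        if x: "a < emeasure N (Pair x -` A)" for x
      proof -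
        have "Pair x -` A \<in> sets borel" using basic sec[of A x] by (simp add: sN)
        then have "emeasure N (Pair x -` A) =
            (SUP K\<in>{K. K \<subseteq> Pair x -` A \<and> compact K}. emeasure N K)"
          using N by (auto simp: regular_borel_prob_def)
        with x obtain K where K: "K \<subseteq> Pair x -` A" "compact K" "a < emeasure N K"
          by (auto simp: less_SUP_iff)
        have "{x} \<times> K \<subseteq> A" using K by auto
        with K(2) basic obtain U where U: "x \<in> U" "open U" "U \<times> K \<subseteq> A"
          using Elementary_Topology.tube_lemma[of K A x] by auto
        have "a < emeasure N (Pair z -` A)" if "z \<in> U" for z
        proof -
          have "K \<subseteq> Pair z -` A" using U that by auto
          then have "emeasure N K \<le> emeasure N (Pair z -` A)"
            using basic by (intro emeasure_mono sec) auto
          with K show ?thesis by simp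
        qed
        with U show ?thesis by auto
      qed
      then have "open {x. a < emeasure N (Pair x -` A)}"
        by (subst open_subopen) blast
      then show "{x \<in> space borel. a < emeasure N (Pair x -` A)} \<in> sets borel" by simp
    qed
  next
    case empty
    show ?case by simp
  next
    case (compl A)
    have "emeasure N (Pair x -` (UNIV - A)) = 1 - emeasure N (Pair x -` A)" for x
      using N.emeasure_space_1 emeasure_compl[OF sec[of A x, OF compl(1)]]
      by (simp add: spN vimage_Diff)
    then show ?case using compl by simp
  next
    case (union A)
    have "emeasure N (Pair x -` (\<Union>i. A i)) = (\<Sum>i. emeasure N (Pair x -` A i))" for x
      unfolding vimage_Union using union
      by (subst suminf_emeasure)
        (auto simp: vimage_UN disjoint_family_on_def intro!: sec)
    then show ?case using union by simp
  qed
qed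

lemma sets_borel_product: "sets (borel_product M N) = sets borel"
  unfolding borel_product_def using sets.sigma_sets_eq[of borel] by simp

lemma emeasure_borel_product:
  fixes M :: "'a::topological_space measure" and N :: "'b::topological_space measure"
  assumes M: "sets M = sets borel" and N: "regular_borel_prob N" and E: "E \<in> sets borel"
  shows "emeasure (borel_product M N) E = (\<integral>\<^sup>+x. emeasure N (Pair x -` E) \<partial>M)"
proof -
  have sN: "sets N = sets borel" using N by (simp add: regular_borel_prob_def)
  have sec: "Pair x -` A \<in> sets N" if "A \<in> sets borel" for A x
    using borel_measurable_Pair_section[OF that] by (simp add: sN)
  have eq: "(\<integral>\<^sup>+x. \<integral>\<^sup>+y. indicator A (x, y) \<partial>N \<partial>M) = (\<integral>\<^sup>+x. emeasure N (Pair x -` A) \<partial>M)"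
    if "A \<in> sets borel" for A
  proof (rule nn_integral_cong)
    fix x
    have "(\<lambda>y. indicator A (x, y)) = (indicator (Pair x -` A) :: _ \<Rightarrow> ennreal)"
      by (auto simp: indicator_def)
    then show "(\<integral>\<^sup>+y. indicator A (x, y) \<partial>N) = emeasure N (Pair x -` A)"
      using sec[OF that] by simp
  qed
  have "emeasure (borel_product M N) E = (\<integral>\<^sup>+x. \<integral>\<^sup>+y. indicator E (x, y) \<partial>N \<partial>M)"
    unfolding borel_product_def
  proof (rule emeasure_measure_of[OF refl])
    let ?B = "sets (measure_of UNIV (sets borel)
      (\<lambda>E. \<integral>\<^sup>+x. \<integral>\<^sup>+y. indicator E (x, y) \<partial>N \<partial>M))"
    let ?P = "\<lambda>E. \<integral>\<^sup>+x. \<integral>\<^sup>+y. indicator E (x, y) \<partial>N \<partial>M"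
    have B: "?B = sets borel"
      using sets_borel_product[of M N] unfolding borel_product_def .
    show "E \<in> ?B" using E B by simp
    show "positive ?B ?P" by (simp add: positive_def)
    show "countably_additive ?B ?P"
      unfolding B countably_additive_def
    proof (intro allI impI)
      fix A :: "nat \<Rightarrow> ('a \<times> 'b) set"
      assume A: "range A \<subseteq> sets borel" "disjoint_family A" "(\<Union>i. A i) \<in> sets borel"
      then have Ai: "A i \<in> sets borel" for i by auto
      have m: "(\<lambda>x. emeasure N (Pair x -` A i)) \<in> borel_measurable M" for i
        using borel_measurable_emeasure_section[OF N Ai[of i]]
        by (simp only: measurable_cong_sets[OF M refl])
      have "(\<Sum>i. ?P (A i)) = (\<integral>\<^sup>+x. (\<Sum>i. emeasure N (Pair x -` A i)) \<partial>M)"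
        using m by (simp add: eq[OF Ai] nn_integral_suminf)
      also have "\<dots> = (\<integral>\<^sup>+x. emeasure N (Pair x -` (\<Union>i. A i)) \<partial>M)"
      proof (rule nn_integral_cong)
        fix x
        show "(\<Sum>i. emeasure N (Pair x -` A i)) = emeasure N (Pair x -` (\<Union>i. A i))"
          unfolding vimage_UN using A(2) sec[OF Ai]
          by (intro suminf_emeasure) (auto simp: disjoint_family_on_def)
      qed
      also have "\<dots> = ?P (\<Union>i. A i)" using A(3) by (simp add: eq)
      finally show "(\<Sum>i. ?P (A i)) = ?P (\<Union>i. A i)" .
    qed
  qed simp
  with eq[OF E] show ?thesis by simp
qed

lemma emeasure_borel_product_Times:
  fixes M :: "'a::topological_space measure" and N :: "'b::topological_space measure"
  assumes M: "sets M = sets borel" and N: "regular_borel_prob N"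
    and A: "A \<in> sets borel" and B: "B \<in> sets borel"
  shows "emeasure (borel_product M N) (A \<times> B) = emeasure M A * emeasure N B"
proof -
  have "fst \<in> borel_measurable (borel :: ('a \<times> 'b) measure)"
    "snd \<in> borel_measurable (borel :: ('a \<times> 'b) measure)"
    by (intro borel_measurable_continuous_onI continuous_intros)+
  from measurable_sets[OF this(1) A] measurable_sets[OF this(2) B]
  have "fst -` A \<inter> snd -` B \<in> sets (borel :: ('a \<times> 'b) measure)" by auto
  moreover have "fst -` A \<inter> snd -` B = A \<times> B" by auto
  ultimately have AB: "A \<times> B \<in> sets borel" by simp
  have "emeasure N (Pair x -` (A \<times> B)) = emeasure N B * indicator A x" for x
    by (cases "x \<in> A") auto
  then have "emeasure (borel_product M N) (A \<times> B) = (\<integral>\<^sup>+x. emeasure N B * indicator A x \<partial>M)"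
    by (simp only: emeasure_borel_product[OF M N AB])
  also have "\<dots> = emeasure M A * emeasure N B"
    using A M by (subst nn_integral_cmult_indicator) (simp_all add: mult.commute)
  finally show ?thesis .
qed

end

(*
  Put A_s f = f * reflected (lam s) up to the choice of sign, so that T_s is A_s followed by its
  adjoint.  Since lam s = lam (s + 1) * kap_s, the measures lam_n, kap_(n-1), ..., kap_1 drive a random
  walk Z_n, ..., Z_1 started at a Haar distributed point Z, and E[f(Z) | Z_s, ..., Z_1] = (A_s f)(Z_s)
  is a reversed martingale with T_s f(Z) = E[(A_s f)(Z_s) | Z] (Rota's dilation).  Doob's
  inequality for the martingale and Jensen's inequality for the conditional expectation on Z give
  the maximal inequality for continuous f >= 0, and it extends to L^p by density.  Convergence is
  clear for continuous f and follows in general from the maximal inequality.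
*)
theory Submission
  imports Defs "HOL-Probability.Giry_Monad" "HOL-Analysis.Urysohn"
begin

section \<open>Integrals of continuous functions on compact spaces\<close>

text \<open>Without second countability a Borel function on a product may fail to be measurable for
  the product sigma-algebra, so a walk on a path space and a direct use of Fubini for Borel
  functions are both out of reach. The proof therefore runs on two levels. The martingale is seen
  only through iterated integrals of continuous functions, which remain continuous, and Doob's
  inequality comes from a pointwise inequality for Burkholder's function, by induction on the steps
  of the walk. Averages of Borel functions are handled as Markov kernels, where regularity of the
  measures supplies measurability. The levels meet in the error f - phi of a continuous
  approximation. Its averages must be L^p contractions, and for Borel functions this rests on m * N
  = m on all Borel sets. Agreement on continuous functions does not settle that while regularity of
  m * N is unknown; \<open>measure_conv_haar\<close> closes the gap. Density is used for finitely
  many s at a time, since every s adds an error of its own; monotone convergence then reaches all s.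
  Jensen's inequality costs no constant, so p/(p-1) is exactly Doob's.\<close>

abbreviation borel_probs :: "'a::topological_space measure set" where
  "borel_probs \<equiv> space (prob_algebra borel)"

lemma borel_probsD:
  assumes "k \<in> borel_probs"
  shows "prob_space k" "sets k = sets borel" "space k = UNIV"
  using assms sets_eq_imp_space_eq[of k borel] by (auto simp: space_prob_algebra)

lemma bounded_range_continuous:
  fixes F :: "'a::topological_space \<Rightarrow> 'b::metric_space"
  assumes "compact (UNIV :: 'a set)" "continuous_on UNIV F"
  shows "bounded (range F)"
  using assms compact_continuous_image compact_imp_bounded by blast

lemma integrable_continuous_compact:
  fixes F :: "'a::topological_space \<Rightarrow> 'b::{banach, second_countable_topology}"
  assumes G: "compact (UNIV :: 'a set)" and k: "k \<in> borel_probs" and F: "continuous_on UNIV F"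
  shows "integrable k F"
proof -
  interpret prob_space k using borel_probsD[OF k] by simp
  obtain B where "\<And>x. norm (F x) \<le> B"
    using bounded_range_continuous[OF G F] by (auto simp: bounded_iff)
  moreover have "F \<in> borel_measurable k"
    using borel_measurable_continuous_onI[OF F] borel_probsD(2)[OF k]
    by (simp cong: measurable_cong_sets)
  ultimately show ?thesis by (intro integrable_const_bound) auto
qed

text \<open>The tube lemma around \<open>{w} \<times> UNIV\<close>: compactness of the second factor
  turns joint continuity into continuity in \<open>w\<close> that is uniform in
  \<open>y\<close>.\<close>

lemma uniform_tube:
  fixes F :: "'w::topological_space \<Rightarrow> 'b::topological_space \<Rightarrow> real"
  assumes G: "compact (UNIV :: 'b set)" and F: "continuous_on UNIV (\<lambda>(w, y). F w y)"
    and e: "e > 0"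
  obtains U where "open U" "w \<in> U" "\<And>v y. v \<in> U \<Longrightarrow> \<bar>F v y - F w y\<bar> < e"
proof -
  have w: "continuous_on UNIV (\<lambda>z :: 'w \<times> 'b. F w (snd z))"
    using continuous_on_compose2[OF F, of UNIV "\<lambda>z. (w, snd z)"]
    by (simp add: continuous_on_Pair continuous_on_snd)
  have F': "continuous_on UNIV (\<lambda>z. F (fst z) (snd z))"
    using F by (simp add: case_prod_unfold)
  define W where "W = {z. \<bar>F (fst z) (snd z) - F w (snd z)\<bar> < e}"
  have "open W" unfolding W_def
    by (intro open_Collect_less continuous_intros F' w)
  moreover have "{w} \<times> UNIV \<subseteq> W" using e by (auto simp: W_def)
  ultimately obtain U where "w \<in> U" "open U" "U \<times> UNIV \<subseteq> W"
    using Elementary_Topology.tube_lemma[OF G] by metis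
  then show thesis by (intro that[of U]) (fastforce simp: W_def)+
qed

lemma continuous_on_section:
  assumes "continuous_on UNIV (\<lambda>(w, y). F w y)"
  shows "continuous_on UNIV (F w)"
  using continuous_on_compose2[OF assms, of UNIV "\<lambda>y. (w, y)"]
  by (simp add: continuous_on_Pair)

text \<open>Dominated convergence would give only sequential continuity, which is too weak without
  first countability. A tube bounds the difference of the integrands on a whole neighbourhood
  instead.\<close>

lemma continuous_on_integral_param:
  fixes F :: "'w::topological_space \<Rightarrow> 'b::topological_space \<Rightarrow> real"
  assumes G: "compact (UNIV :: 'b set)" and k: "k \<in> borel_probs"
    and F: "continuous_on UNIV (\<lambda>(w, y). F w y)"
  shows "continuous_on UNIV (\<lambda>w. \<integral>y. F w y \<partial>k)"
proof -
  interpret prob_space k using borel_probsD[OF k] by simp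
  have int: "integrable k (F w)" for w
    by (intro integrable_continuous_compact G k continuous_on_section[OF F])
  have "((\<lambda>w. \<integral>y. F w y \<partial>k) \<longlongrightarrow> (\<integral>y. F w y \<partial>k)) (at w)" for w
  proof (rule tendstoI)
    fix e :: real assume e: "e > 0"
    obtain U where U: "open U" "w \<in> U" "\<And>v y. v \<in> U \<Longrightarrow> \<bar>F v y - F w y\<bar> < e / 2"
      by (rule uniform_tube[OF G F half_gt_zero[OF e], of w]) blast
    have "dist (\<integral>y. F v y \<partial>k) (\<integral>y. F w y \<partial>k) < e" if v: "v \<in> U" for v
    proof -
      have "\<bar>(\<integral>y. F v y \<partial>k) - (\<integral>y. F w y \<partial>k)\<bar> = \<bar>\<integral>y. F v y - F w y \<partial>k\<bar>"
        using int by simp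
      also have "\<dots> \<le> (\<integral>y. \<bar>F v y - F w y\<bar> \<partial>k)" by (rule integral_abs_bound)
      also have "\<dots> \<le> (\<integral>y. e / 2 \<partial>k)"
        using int U(3)[OF v] by (intro integral_mono) (auto intro: less_imp_le)
      finally show ?thesis using e by (simp add: dist_real_def prob_space)
    qed
    then show "\<forall>\<^sub>F v in at w. dist (\<integral>y. F v y \<partial>k) (\<integral>y. F w y \<partial>k) < e"
      using U unfolding eventually_at_topological by blast
  qed
  then show ?thesis by (auto simp: continuous_on_def)
qed

text \<open>Without second countability a continuous function need not obviously be measurable for
  the product \<open>\<sigma>\<close>-algebra; on compact spaces it is a uniform limit of functions that
  depend on the first variable only through a finite Borel partition.\<close>

lemma borel_measurable_pair_continuous:
  fixes F :: "'w::topological_space \<Rightarrow> 'b::topological_space \<Rightarrow> real"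
  assumes W: "compact (UNIV :: 'w set)" and G: "compact (UNIV :: 'b set)"
    and M: "M \<in> borel_probs" and N: "N \<in> borel_probs"
    and F: "continuous_on UNIV (\<lambda>(w, y). F w y)"
  shows "(\<lambda>(w, y). F w y) \<in> borel_measurable (M \<Otimes>\<^sub>M N)"
proof -
  have sM: "sets M = sets borel" and sN: "sets N = sets borel"
    using borel_probsD M N by auto
  have spM: "space M = UNIV" by (rule borel_probsD(3)[OF M])
  have "\<exists>H. H \<in> borel_measurable (M \<Otimes>\<^sub>M N) \<and> (\<forall>w y. \<bar>F w y - H (w, y)\<bar> < 1 / Suc n)" for n
  proof -
    have "\<forall>w. \<exists>U. open U \<and> w \<in> U \<and> (\<forall>v\<in>U. \<forall>y. \<bar>F v y - F w y\<bar> < 1 / Suc n)"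
    proof
      fix w
      show "\<exists>U. open U \<and> w \<in> U \<and> (\<forall>v\<in>U. \<forall>y. \<bar>F v y - F w y\<bar> < 1 / Suc n)"
        by (rule uniform_tube[OF G F, of "1 / Suc n" w]) auto
    qed
    from choice[OF this] obtain U where U: "\<And>w. open (U w)" "\<And>w. w \<in> U w"
      "\<And>w v y. v \<in> U w \<Longrightarrow> \<bar>F v y - F w y\<bar> < 1 / Suc n" by auto
    obtain C where C: "finite C" "UNIV \<subseteq> (\<Union>w\<in>C. U w)"
      by (rule compactE_image[OF W, of UNIV U]) (use U(1,2) in auto)
    obtain ws where ws: "set ws = C" using finite_list[OF C(1)] by blast
    \<comment> \<open>Taking the least index makes the finite open cover disjoint: the level sets of
      \<open>i\<close> are the Borel partition, and on each of them \<open>F\<close> stays close to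
      its values at one point of \<open>ws\<close>.\<close>
    define i where "i w = (LEAST j. j < length ws \<and> w \<in> U (ws ! j))" for w
    have ex: "\<exists>j. j < length ws \<and> w \<in> U (ws ! j)" for w
    proof -
      obtain v where "v \<in> C" "w \<in> U v" using C(2) by blast
      then show ?thesis using ws by (auto simp: in_set_conv_nth)
    qed
    have i: "i w < length ws \<and> w \<in> U (ws ! i w)" for w
      unfolding i_def by (rule LeastI_ex[OF ex])
    have "i \<in> M \<rightarrow>\<^sub>M count_space UNIV"
    proof (unfold i_def, rule measurable_Least)
      fix j
      have "{w. j < length ws \<and> w \<in> U (ws ! j)} \<in> sets M"
        unfolding sM by (cases "j < length ws") (auto simp: U(1))
      then show "Measurable.pred M (\<lambda>w. j < length ws \<and> w \<in> U (ws ! j))"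
        by (simp add: pred_def spM)
    qed
    then have i_meas: "(\<lambda>z. i (fst z)) \<in> M \<Otimes>\<^sub>M N \<rightarrow>\<^sub>M count_space UNIV" by simp
    have Fm: "(\<lambda>z. F w (snd z)) \<in> borel_measurable (M \<Otimes>\<^sub>M N)" for w
    proof -
      have "F w \<in> borel_measurable N"
        using borel_measurable_continuous_onI[OF continuous_on_section[OF F]] sN
        by (simp cong: measurable_cong_sets)
      then show ?thesis by simp
    qed
    define H where "H z = F (ws ! i (fst z)) (snd z)" for z
    have "H \<in> borel_measurable (M \<Otimes>\<^sub>M N)"
      unfolding H_def
      by (rule measurable_compose_countable[of "\<lambda>j z. F (ws ! j) (snd z)", OF Fm i_meas])
    moreover have "\<bar>F w y - H (w, y)\<bar> < 1 / Suc n" for w y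
      using U(3)[of w "ws ! i w" y] i[of w] by (simp add: H_def)
    ultimately show ?thesis by blast
  qed
  then have "\<forall>n. \<exists>H. H \<in> borel_measurable (M \<Otimes>\<^sub>M N) \<and> (\<forall>w y. \<bar>F w y - H (w, y)\<bar> < 1 / Suc n)"
    by blast
  from choice[OF this] obtain H where H: "\<And>n. H n \<in> borel_measurable (M \<Otimes>\<^sub>M N)"
    "\<And>n w y. \<bar>F w y - H n (w, y)\<bar> < 1 / Suc n" by auto
  have lim: "(\<lambda>n. H n z) \<longlonglongrightarrow> (\<lambda>(w, y). F w y) z" for z
  proof (rule metric_LIMSEQ_I)
    fix r :: real assume "r > 0"
    then obtain n0 where n0: "1 / Suc n0 < r" using nat_approx_posE by blast
    have "dist (H n z) ((\<lambda>(w, y). F w y) z) < r" if "n \<ge> n0" for n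
    proof -
      have "1 / Suc n \<le> 1 / Suc n0" using that by (simp add: frac_le)
      then show ?thesis using H(2)[of "fst z" "snd z" n] n0
        by (simp add: dist_real_def case_prod_unfold abs_minus_commute)
    qed
    then show "\<exists>n0. \<forall>n\<ge>n0. dist (H n z) ((\<lambda>(w, y). F w y) z) < r" by blast
  qed
  show ?thesis by (rule borel_measurable_LIMSEQ_metric[OF H(1) lim])
qed

text \<open>Fubini on the product sigma-algebra, where continuity makes the integrand measurable.
  Every exchange of two integrals in the proof goes through this lemma and so concerns continuous
  integrands.\<close>

lemma integral_swap_continuous:
  fixes F :: "'w::topological_space \<Rightarrow> 'b::topological_space \<Rightarrow> real"
  assumes W: "compact (UNIV :: 'w set)" and G: "compact (UNIV :: 'b set)"
    and M: "M \<in> borel_probs" and N: "N \<in> borel_probs"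
    and F: "continuous_on UNIV (\<lambda>(w, y). F w y)"
  shows "(\<integral>w. \<integral>y. F w y \<partial>N \<partial>M) = (\<integral>y. \<integral>w. F w y \<partial>M \<partial>N)"
proof -
  interpret M: prob_space M using borel_probsD[OF M] by simp
  interpret N: prob_space N using borel_probsD[OF N] by simp
  interpret P: pair_prob_space N M ..
  interpret Q: pair_prob_space M N ..
  have "compact (UNIV :: ('w \<times> 'b) set)"
    using compact_Times[OF W G] by simp
  then obtain B where B: "\<And>z. \<bar>(\<lambda>(w, y). F w y) z\<bar> \<le> B"
    using bounded_range_continuous[OF _ F] by (auto simp: bounded_iff)
  have m: "(\<lambda>(w, y). F w y) \<in> borel_measurable (M \<Otimes>\<^sub>M N)"
    by (rule borel_measurable_pair_continuous[OF W G M N F])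
  have "integrable (M \<Otimes>\<^sub>M N) (\<lambda>(w, y). F w y)"
    by (rule Q.P.integrable_const_bound[where B=B]) (use B m in auto)
  then show ?thesis by (rule Q.Fubini_integral[symmetric])
qed

section \<open>Doob's inequality along a chain of convolutions\<close>

text \<open>Let Z be Haar distributed and Y independent of Z with law \<open>k\<close>. Then
  \<open>fwd_avg k f\<close> represents E[f(Z + Y) | Z] as a function of Z, and
  \<open>bwd_avg k f\<close> represents E[f(Z) | Z + Y] as a function of Z + Y. The two operators
  are adjoint, see \<open>integral_fwd_avg_mult\<close>.\<close>

definition fwd_avg :: "'a::topological_ab_group_add measure \<Rightarrow> ('a \<Rightarrow> real) \<Rightarrow> 'a \<Rightarrow> real" where
  "fwd_avg k f z = (\<integral>y. f (z + y) \<partial>k)"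

definition bwd_avg :: "'a::topological_ab_group_add measure \<Rightarrow> ('a \<Rightarrow> real) \<Rightarrow> 'a \<Rightarrow> real" where
  "bwd_avg k f z = (\<integral>y. f (z - y) \<partial>k)"

text \<open>
  For \<open>ks = [k\<^sub>1, \<dots>, k\<^sub>n]\<close> consider the walk \<open>Z\<^sub>0 = z\<close>, \<open>Z\<^sub>i = Z\<^sub>i\<^sub>-\<^sub>1 + Y\<^sub>i\<close> with independent steps
  \<open>Y\<^sub>i\<close> of law \<open>k\<^sub>i\<close>, and put \<open>g\<^sub>0 = f\<close>, \<open>g\<^sub>i = bwd_avg k\<^sub>i g\<^sub>i\<^sub>-\<^sub>1\<close>.  Then \<open>chain_exp ks f \<psi> a z\<close> is the
  expectation of \<open>\<psi>\<close> at the maximum of \<open>a\<close> and all \<open>g\<^sub>i(Z\<^sub>i)\<close>, and \<open>chain_maps ks f\<close> collects the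
  functions \<open>z \<mapsto> E g\<^sub>i(Z\<^sub>i)\<close>.  Iterated integrals of continuous functions avoid measures on a path
  space, where measurability fails without second countability.
\<close>

primrec chain_exp ::
  "'a::topological_ab_group_add measure list \<Rightarrow> ('a \<Rightarrow> real) \<Rightarrow> (real \<Rightarrow> real) \<Rightarrow> real \<Rightarrow> 'a \<Rightarrow> real"
where
  "chain_exp [] f \<psi> a z = \<psi> (max a (f z))"
| "chain_exp (k # ks) f \<psi> a z =
     (\<integral>y. chain_exp ks (bwd_avg k f) \<psi> (max a (f z)) (z + y) \<partial>k)"

primrec chain_maps :: "'a::topological_ab_group_add measure list \<Rightarrow> ('a \<Rightarrow> real) \<Rightarrow> ('a \<Rightarrow> real) set"
where
  "chain_maps [] f = {f}"
| "chain_maps (k # ks) f = insert f (fwd_avg k ` chain_maps ks (bwd_avg k f))"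

text \<open>The graph of x^p lies above its tangent at \<open>y\<close>. In this form it serves four
  times: for Burkholder's function, for Minkowski's inequality, and for the two versions of Jensen's
  inequality.\<close>

lemma Young_powr:
  fixes p x y :: real
  assumes p: "p > 1" and x: "x \<ge> 0" and y: "y \<ge> 0"
  shows "p * x * y powr (p - 1) \<le> (p - 1) * y powr p + x powr p"
proof -
  define q where "q = p / (p - 1)"
  have q: "q > 1" "1 / p + 1 / q = 1" using p by (auto simp: q_def field_simps)
  have "x * y powr (p - 1) \<le> x powr p / p + (y powr (p - 1)) powr q / q"
    by (rule Youngs_inequality[OF p q x]) auto
  also have "(y powr (p - 1)) powr q = y powr p" using p by (simp add: powr_powr q_def)
  finally have "p * (x * y powr (p - 1)) \<le> p * (x powr p / p + y powr p / q)"
    using p by (intro mult_left_mono) auto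
  also have "\<dots> = x powr p + (p - 1) * y powr p"
    using p by (simp add: q_def field_simps)
  finally show ?thesis by (simp add: algebra_simps)
qed

lemma continuous_abs_powr: "r > 0 \<Longrightarrow> continuous_on UNIV (\<lambda>y :: real. \<bar>y\<bar> powr r)"
  by (intro continuous_on_powr' continuous_intros) auto

context
  assumes G: "compact (UNIV :: 'a::topological_ab_group_add set)"
begin

section \<open>Continuity, monotonicity and linearity of the iterated integrals\<close>

lemma continuous_fwd_avg:
  fixes f :: "'a \<Rightarrow> real"
  assumes "k \<in> borel_probs" "continuous_on UNIV f"
  shows "continuous_on UNIV (fwd_avg k f)"
proof -
  have "continuous_on UNIV (\<lambda>(z, y). f (z + y))"
    unfolding case_prod_unfold
    by (rule continuous_on_compose2[OF assms(2)]) (auto intro!: continuous_intros)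
  from continuous_on_integral_param[OF G assms(1) this] show ?thesis
    by (simp add: fwd_avg_def[abs_def])
qed

lemma continuous_bwd_avg:
  fixes f :: "'a \<Rightarrow> real"
  assumes "k \<in> borel_probs" "continuous_on UNIV f"
  shows "continuous_on UNIV (bwd_avg k f)"
proof -
  have "continuous_on UNIV (\<lambda>(z, y). f (z - y))"
    unfolding case_prod_unfold
    by (rule continuous_on_compose2[OF assms(2)]) (auto intro!: continuous_intros)
  from continuous_on_integral_param[OF G assms(1) this] show ?thesis
    by (simp add: bwd_avg_def[abs_def])
qed

text \<open>The induction needs joint continuity in \<open>a\<close> and \<open>z\<close>, because
  the recursive call under the integral changes both arguments at once.\<close>

lemma continuous_chain_exp:
  fixes f :: "'a \<Rightarrow> real"
  assumes "set ks \<subseteq> borel_probs" "continuous_on UNIV f" "continuous_on UNIV \<psi>"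
  shows "continuous_on UNIV (\<lambda>(a, z). chain_exp ks f \<psi> a z)"
  using assms
proof (induction ks arbitrary: f)
  case Nil
  have "continuous_on UNIV (\<lambda>z :: real \<times> 'a. f (snd z))"
    by (rule continuous_on_compose2[OF Nil(2)]) (auto intro!: continuous_intros)
  then show ?case
    unfolding chain_exp.simps case_prod_unfold
    by (intro continuous_on_compose2[OF Nil(3)] continuous_on_max continuous_intros) auto
next
  case (Cons k ks)
  then have k: "k \<in> borel_probs" by simp
  have IH: "continuous_on UNIV (\<lambda>z. chain_exp ks (bwd_avg k f) \<psi> (fst z) (snd z))"
    using Cons.IH[of "bwd_avg k f"] Cons.prems continuous_bwd_avg[OF k]
    by (simp add: case_prod_unfold)
  have f: "continuous_on UNIV (\<lambda>w :: (real \<times> 'a) \<times> 'a. f (snd (fst w)))"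
    by (rule continuous_on_compose2[OF Cons.prems(2)]) (auto intro!: continuous_intros)
  have "continuous_on UNIV (\<lambda>w :: (real \<times> 'a) \<times> 'a.
      chain_exp ks (bwd_avg k f) \<psi> (max (fst (fst w)) (f (snd (fst w)))) (snd (fst w) + snd w))"
    using continuous_on_compose2[OF IH, of UNIV
        "\<lambda>w :: (real \<times> 'a) \<times> 'a. (max (fst (fst w)) (f (snd (fst w))), snd (fst w) + snd w)"]
    by (simp add: f continuous_on_max continuous_on_Pair continuous_on_fst continuous_on_snd continuous_on_add)
  then have "continuous_on UNIV (\<lambda>w :: real \<times> 'a.
      \<integral>y. chain_exp ks (bwd_avg k f) \<psi> (max (fst w) (f (snd w))) (snd w + y) \<partial>k)"
    by (intro continuous_on_integral_param[OF G k]) (simp add: case_prod_unfold)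
  then show ?case by (simp add: case_prod_unfold)
qed

lemma continuous_chain_exp_section:
  fixes f :: "'a \<Rightarrow> real"
  assumes "set ks \<subseteq> borel_probs" "continuous_on UNIV f" "continuous_on UNIV \<psi>"
  shows "continuous_on UNIV (chain_exp ks f \<psi> a)"
  by (rule continuous_on_section[OF continuous_chain_exp[OF assms]])

lemma integrable_chain_exp:
  fixes f :: "'a \<Rightarrow> real"
  assumes "set ks \<subseteq> borel_probs" "continuous_on UNIV f" "continuous_on UNIV \<psi>" "k \<in> borel_probs"
  shows "integrable k (\<lambda>y. chain_exp ks f \<psi> a (z + y))"
  by (rule integrable_continuous_compact[OF G assms(4)],
      rule continuous_on_compose2[OF continuous_chain_exp_section[OF assms(1-3)]])
    (auto intro!: continuous_intros)

text \<open>The outer function is evaluated only at maxima that are at least \<open>a\<close>. For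
  \<open>a \<ge> 0\<close> a comparison on the nonnegative reals is therefore enough, which is where
  \<open>Young_powr\<close> is available.\<close>

lemma chain_exp_mono:
  fixes f :: "'a \<Rightarrow> real"
  assumes "set ks \<subseteq> borel_probs" "continuous_on UNIV f"
    "continuous_on UNIV \<psi>" "continuous_on UNIV \<phi>" "a \<ge> 0" "\<And>y. y \<ge> 0 \<Longrightarrow> \<psi> y \<le> \<phi> y"
  shows "chain_exp ks f \<psi> a z \<le> chain_exp ks f \<phi> a z"
  using assms
proof (induction ks arbitrary: f a z)
  case (Cons k ks)
  then show ?case
    by (auto intro!: integral_mono integrable_chain_exp continuous_bwd_avg Cons.IH)
qed auto

lemma chain_exp_lin:
  fixes f :: "'a \<Rightarrow> real"
  assumes "set ks \<subseteq> borel_probs" "continuous_on UNIV f"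
    "continuous_on UNIV \<psi>" "continuous_on UNIV \<phi>"
  shows "chain_exp ks f (\<lambda>y. b * \<psi> y + c * \<phi> y) a z = b * chain_exp ks f \<psi> a z + c * chain_exp ks f \<phi> a z"
  using assms
proof (induction ks arbitrary: f a z)
  case (Cons k ks)
  then show ?case
    by (simp add: integrable_chain_exp continuous_bwd_avg)
qed auto

lemma chain_exp_const:
  fixes f :: "'a \<Rightarrow> real"
  assumes "set ks \<subseteq> borel_probs"
  shows "chain_exp ks f (\<lambda>_. c) a z = c"
  using assms
proof (induction ks arbitrary: f a z)
  case (Cons k ks)
  then interpret prob_space k using borel_probsD(1)[of k] by simp
  show ?case using Cons by (simp add: prob_space)
qed auto

text \<open>Moves a value already seen from the running maximum into the outer function, so that
  \<open>chain_exp_mono\<close> can compare the functional with and without that value.\<close>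

lemma chain_exp_max:
  fixes f :: "'a \<Rightarrow> real"
  shows "chain_exp ks f \<psi> (max b a) z = chain_exp ks f (\<lambda>y. \<psi> (max b y)) a z"
  by (induction ks arbitrary: f a z) (simp_all add: max.assoc)

lemma chain_exp_id_ge:
  fixes f :: "'a \<Rightarrow> real"
  assumes "set ks \<subseteq> borel_probs" "continuous_on UNIV f"
  shows "a \<le> chain_exp ks f (\<lambda>y. y) a z"
  using assms
proof (induction ks arbitrary: f a z)
  case (Cons k ks)
  then have k: "k \<in> borel_probs" by simp
  interpret prob_space k using borel_probsD(1)[OF k] .
  have "max a (f z) \<le> chain_exp ks (bwd_avg k f) (\<lambda>y. y) (max a (f z)) (z + y)" for y
    using Cons k by (intro Cons.IH) (auto intro: continuous_bwd_avg)
  then have "(\<integral>y. max a (f z) \<partial>k) \<le> (\<integral>y. chain_exp ks (bwd_avg k f) (\<lambda>y. y) (max a (f z)) (z + y) \<partial>k)"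
    using Cons k by (intro integral_mono integrable_chain_exp continuous_bwd_avg) auto
  then show ?case by (simp add: prob_space)
qed auto

section \<open>Expectations of single values against the expectation of the maximum\<close>

lemma chain_maps_continuous:
  fixes f :: "'a \<Rightarrow> real"
  assumes "set ks \<subseteq> borel_probs" "continuous_on UNIV f" "t \<in> chain_maps ks f"
  shows "continuous_on UNIV t"
  using assms
proof (induction ks arbitrary: f t)
  case (Cons k ks)
  then have k: "k \<in> borel_probs" and ks: "set ks \<subseteq> borel_probs" by auto
  have IH: "continuous_on UNIV (fwd_avg k u)" if "u \<in> chain_maps ks (bwd_avg k f)" for u
    by (rule continuous_fwd_avg[OF k Cons.IH[OF ks continuous_bwd_avg[OF k Cons.prems(2)] that]])
  from Cons.prems(3) consider "t = f" | u where "u \<in> chain_maps ks (bwd_avg k f)" "t = fwd_avg k u"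
    by auto
  then show ?case using IH Cons.prems(2) by cases simp_all
qed simp

text \<open>Each \<open>t z\<close> is the expectation of one value along the walk, and that value
  is one of the terms of the running maximum. For \<open>t = f\<close> it has already entered the
  accumulated maximum; otherwise it appears later in the recursion.\<close>

lemma chain_maps_le_chain_exp:
  fixes f :: "'a \<Rightarrow> real"
  assumes "set ks \<subseteq> borel_probs" "continuous_on UNIV f" "t \<in> chain_maps ks f"
  shows "t z \<le> chain_exp ks f (\<lambda>y. y) a z"
  using assms
proof (induction ks arbitrary: f a z t)
  case (Cons k ks)
  then have k: "k \<in> borel_probs" and ks: "set ks \<subseteq> borel_probs" by auto
  interpret prob_space k using borel_probsD(1)[OF k] .
  have cf: "continuous_on UNIV (bwd_avg k f)" by (rule continuous_bwd_avg[OF k Cons.prems(2)])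
  have int: "integrable k (\<lambda>y. chain_exp ks (bwd_avg k f) (\<lambda>y. y) b (z + y))" for b
    using k ks cf by (intro integrable_chain_exp) auto
  consider "t = f" | u where "u \<in> chain_maps ks (bwd_avg k f)" "t = fwd_avg k u"
    using Cons.prems(3) by auto
  then show ?case
  proof cases
    case 1
    have "(\<integral>y. f z \<partial>k) \<le> (\<integral>y. chain_exp ks (bwd_avg k f) (\<lambda>y. y) (max a (f z)) (z + y) \<partial>k)"
      using chain_exp_id_ge[OF ks cf, of "max a (f z)"] int by (intro integral_mono) auto
    then show ?thesis by (simp add: 1 prob_space)
  next
    case 2
    have "continuous_on UNIV (\<lambda>y. u (z + y))"
      by (rule continuous_on_compose2[OF chain_maps_continuous[OF ks cf 2(1)]])
        (auto intro!: continuous_intros)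
    then have "integrable k (\<lambda>y. u (z + y))" by (rule integrable_continuous_compact[OF G k])
    then show ?thesis
      unfolding 2(2) fwd_avg_def chain_exp.simps
      by (intro integral_mono int Cons.IH[OF ks cf 2(1)])
  qed
qed auto

section \<open>Time reversal and Doob's inequality\<close>

text \<open>Fubini, then the substitution of \<open>z - y\<close> for \<open>z\<close>, which
  preserves \<open>m\<close>. This adjointness stands in for the reversed martingale
  property.\<close>

lemma integral_fwd_avg_mult:
  fixes f g :: "'a \<Rightarrow> real"
  assumes m: "m \<in> borel_probs" "\<And>a. distr m borel (\<lambda>x. a + x) = m"
    and k: "k \<in> borel_probs" and f: "continuous_on UNIV f" and g: "continuous_on UNIV g"
  shows "(\<integral>z. g z * fwd_avg k f z \<partial>m) = (\<integral>z. bwd_avg k g z * f z \<partial>m)"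
proof -
  have 1: "continuous_on UNIV (\<lambda>(z, y). g z * f (z + y))"
    unfolding case_prod_unfold
    by (intro continuous_on_mult continuous_on_compose2[OF f] continuous_on_compose2[OF g])
      (auto intro!: continuous_intros)
  have 2: "continuous_on UNIV (\<lambda>(z, y). g (z - y) * f z)"
    unfolding case_prod_unfold
    by (intro continuous_on_mult continuous_on_compose2[OF f] continuous_on_compose2[OF g])
      (auto intro!: continuous_intros)
  have sm: "sets m = sets borel" by (rule borel_probsD(2)[OF m(1)])
  have inv: "(\<integral>z. g z * f (z + y) \<partial>m) = (\<integral>z. g (z - y) * f z \<partial>m)" for y
  proof -
    have meas: "(\<lambda>x. y + x) \<in> m \<rightarrow>\<^sub>M borel"
      using borel_measurable_continuous_onI[of "\<lambda>x. y + x"] sm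
      by (simp add: continuous_intros cong: measurable_cong_sets)
    have c: "continuous_on UNIV (\<lambda>z. g (z - y) * f z)"
      by (intro continuous_on_mult continuous_on_compose2[OF f] continuous_on_compose2[OF g])
        (auto intro!: continuous_intros)
    have "(\<integral>z. g (z - y) * f z \<partial>m) = (\<integral>z. g (z - y) * f z \<partial>(distr m borel (\<lambda>x. y + x)))"
      by (simp add: m(2))
    also have "\<dots> = (\<integral>z. g z * f (z + y) \<partial>m)"
      by (subst integral_distr[OF meas borel_measurable_continuous_onI[OF c]])
        (simp add: add.commute)
    finally show ?thesis ..
  qed
  have "(\<integral>z. g z * fwd_avg k f z \<partial>m) = (\<integral>z. \<integral>y. g z * f (z + y) \<partial>k \<partial>m)"
    by (simp add: fwd_avg_def)
  also have "\<dots> = (\<integral>y. \<integral>z. g z * f (z + y) \<partial>m \<partial>k)"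
    by (rule integral_swap_continuous[OF G G m(1) k 1])
  also have "\<dots> = (\<integral>y. \<integral>z. g (z - y) * f z \<partial>m \<partial>k)" by (simp only: inv)
  also have "\<dots> = (\<integral>z. \<integral>y. g (z - y) * f z \<partial>k \<partial>m)"
    by (rule integral_swap_continuous[OF G G m(1) k 2, symmetric])
  also have "\<dots> = (\<integral>z. bwd_avg k g z * f z \<partial>m)" by (simp add: bwd_avg_def)
  finally show ?thesis .
qed

lemma integral_fwd_avg:
  fixes f :: "'a \<Rightarrow> real"
  assumes m: "m \<in> borel_probs" "\<And>a. distr m borel (\<lambda>x. a + x) = m"
    and k: "k \<in> borel_probs" and f: "continuous_on UNIV f"
  shows "(\<integral>z. fwd_avg k f z \<partial>m) = (\<integral>z. f z \<partial>m)"
proof -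
  interpret prob_space k using borel_probsD(1)[OF k] .
  show ?thesis using integral_fwd_avg_mult[OF m k f, of "\<lambda>_. 1"] by (simp add: bwd_avg_def prob_space)
qed

text \<open>
  Burkholder's function for Doob's inequality, \<open>\<Phi> x y = p y^p - p\<^sup>2/(p - 1) x y^(p - 1)\<close>, is linear in
  the martingale value \<open>x\<close>, satisfies \<open>\<Phi> x (max x y) \<le> \<Phi> x y\<close>, and is nonpositive for \<open>y = x\<close>.
  The martingale runs towards the start of the list; invariance of \<open>m\<close> reverses time.
\<close>

lemma Doob_functional_nonpos:
  fixes f :: "'a \<Rightarrow> real"
  assumes p: "p > 1" and m: "m \<in> borel_probs" "\<And>a. distr m borel (\<lambda>x. a + x) = m"
    and "set ks \<subseteq> borel_probs" "continuous_on UNIV f" "\<And>x. f x \<ge> 0"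
  shows "(\<integral>z. p * chain_exp ks f (\<lambda>y. \<bar>y\<bar> powr p) 0 z
     - p\<^sup>2 / (p - 1) * (f z * chain_exp ks f (\<lambda>y. \<bar>y\<bar> powr (p - 1)) 0 z) \<partial>m) \<le> 0"
  using assms(4-)
proof (induction ks arbitrary: f)
  case Nil
  have "p * f z powr p - p\<^sup>2 / (p - 1) * (f z * f z powr (p - 1)) \<le> 0" for z
  proof -
    have "f z * f z powr (p - 1) = f z powr p"
      using Nil(3)[of z] by (cases "f z = 0") (auto simp: powr_mult_base)
    \<comment> \<open>The base case is Burkholder's function on the diagonal, where it equals (p -
      p^2/(p-1)) x^p = - p/(p-1) x^p.\<close>
    moreover have "p \<le> p\<^sup>2 / (p - 1)" using p by (simp add: field_simps power2_eq_square)
    ultimately show ?thesis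
      using mult_right_mono[of p "p\<^sup>2 / (p - 1)" "f z powr p"] by simp
  qed
  then have "0 \<le> (\<integral>z. - (p * f z powr p - p\<^sup>2 / (p - 1) * (f z * f z powr (p - 1))) \<partial>m)"
    by (intro Bochner_Integration.integral_nonneg) (simp only: neg_0_le_iff_le)
  then have "(\<integral>z. p * f z powr p - p\<^sup>2 / (p - 1) * (f z * f z powr (p - 1)) \<partial>m) \<le> 0"
    by (simp only: integral_minus neg_0_le_iff_le)
  then show ?case using Nil(3) by (simp add: max_absorb2)
next
  case (Cons k ks)
  then have k: "k \<in> borel_probs" and ks: "set ks \<subseteq> borel_probs" by auto
  interpret prob_space k using borel_probsD(1)[OF k] .
  \<comment> \<open>With this constant the derivative of p y^p - c x y^(p-1) in y is p^2 y^(p-2) (y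
    - x). For y < x the function thus decreases towards its value at y = x, which is the reason why
    replacing y by the maximum of x and y does not raise it.\<close>
  define c where "c = p\<^sup>2 / (p - 1)"
  let ?f = "bwd_avg k f"
  let ?P = "\<lambda>y :: real. \<bar>y\<bar> powr p"
  let ?P1 = "\<lambda>y :: real. \<bar>y\<bar> powr (p - 1)"
  have P: "continuous_on UNIV ?P" "continuous_on UNIV ?P1"
    using p by (auto intro: continuous_abs_powr)
  have P': "continuous_on UNIV (\<lambda>y. ?P (max x y))" "continuous_on UNIV (\<lambda>y. ?P1 (max x y))" for x
    using p by (auto intro!: continuous_on_compose2[OF P(1)] continuous_on_compose2[OF P(2)] continuous_on_max continuous_intros)
  have cf: "continuous_on UNIV ?f" by (rule continuous_bwd_avg[OF k Cons.prems(2)])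
  have f0: "?f x \<ge> 0" for x unfolding bwd_avg_def by (intro integral_nonneg_AE) (auto simp: Cons.prems(3))
  let ?R = "chain_exp ks ?f"
  have cR: "continuous_on UNIV (?R ?P 0)" "continuous_on UNIV (?R ?P1 0)"
    using P by (auto intro: continuous_chain_exp_section[OF ks cf])
  have int: "integrable k (\<lambda>y. ?R \<psi> b (z + y))" if "continuous_on UNIV \<psi>" for \<psi> b z
    by (rule integrable_chain_exp[OF ks cf that k])
  \<comment> \<open>Leaving the first value \<open>f z\<close> out of the running maximum can only
    raise the functional. What remains is an average over the shorter chain.\<close>
  have step: "p * chain_exp (k # ks) f ?P 0 z - c * (f z * chain_exp (k # ks) f ?P1 0 z)
      \<le> p * fwd_avg k (?R ?P 0) z - c * (f z * fwd_avg k (?R ?P1 0) z)" for z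
  proof -
    define x where "x = f z"
    have x: "x \<ge> 0" by (simp add: x_def Cons.prems(3))
    have ineq: "p * ?P (max x y) - c * x * ?P1 (max x y) \<le> p * ?P y - c * x * ?P1 y" if y: "y \<ge> 0" for y
    proof (cases "x \<le> y")
      case False
      have "x * x powr (p - 1) = x powr p" using False y by (simp add: powr_mult_base)
      then have "c * x * x powr (p - 1) = c * x powr p" by (simp add: mult.assoc)
      \<comment> \<open>Scaled by p/(p-1), Young's inequality says exactly that Burkholder's
        function at (x, x) is at most its value at (x, y).\<close>
      moreover have "p / (p - 1) * (p * x * y powr (p - 1)) \<le> p / (p - 1) * ((p - 1) * y powr p + x powr p)"
        using p by (intro mult_left_mono Young_powr x y) auto
      then have "c * x * y powr (p - 1) \<le> p * y powr p + p / (p - 1) * x powr p"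
        using p by (simp add: c_def power2_eq_square distrib_left mult.assoc)
      moreover have "c = p + p / (p - 1)" using p by (simp add: c_def field_simps power2_eq_square)
      then have "c * x powr p = p * x powr p + p / (p - 1) * x powr p" by (simp only: distrib_right)
      ultimately show ?thesis using False x y by (simp add: max_absorb1)
    qed (use x in \<open>simp add: max_absorb2\<close>)
    have "p * chain_exp (k # ks) f ?P 0 z - c * (x * chain_exp (k # ks) f ?P1 0 z)
        = (\<integral>y. p * ?R (\<lambda>y. ?P (max x y)) 0 (z + y) + (- (c * x)) * ?R (\<lambda>y. ?P1 (max x y)) 0 (z + y) \<partial>k)"
    proof -
      have e: "?R (\<lambda>y. \<psi> (max x y)) 0 w = ?R \<psi> x w" for \<psi> w
        using chain_exp_max[of ks ?f \<psi> x 0 w] x by (simp add: max_absorb1)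
      have mx: "max 0 (f z) = x" using x by (simp add: x_def)
      show ?thesis
        unfolding e[of ?P] e[of ?P1] chain_exp.simps mx
        using int[OF P(1)] int[OF P(2)] by (simp add: mult.assoc)
    qed
    also have "\<dots> \<le> (\<integral>y. p * ?R ?P 0 (z + y) + (- (c * x)) * ?R ?P1 0 (z + y) \<partial>k)"
    proof (intro integral_mono)
      fix y
      have "?R (\<lambda>y. p * ?P (max x y) + (- (c * x)) * ?P1 (max x y)) 0 (z + y)
          \<le> ?R (\<lambda>y. p * ?P y + (- (c * x)) * ?P1 y) 0 (z + y)"
      proof (rule chain_exp_mono[OF ks cf])
        show "p * ?P (max x y) + (- (c * x)) * ?P1 (max x y) \<le> p * ?P y + (- (c * x)) * ?P1 y"
          if "y \<ge> 0" for y using ineq[OF that] by simp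
      qed (intro continuous_on_add continuous_on_mult continuous_on_const P P' order_refl)+
      then show "p * ?R (\<lambda>y. ?P (max x y)) 0 (z + y) + (- (c * x)) * ?R (\<lambda>y. ?P1 (max x y)) 0 (z + y)
          \<le> p * ?R ?P 0 (z + y) + (- (c * x)) * ?R ?P1 0 (z + y)"
        unfolding chain_exp_lin[OF ks cf P, of p "- (c * x)" 0 "z + y"]
          chain_exp_lin[OF ks cf P', of p x "- (c * x)" x 0 "z + y"] .
    qed (intro Bochner_Integration.integrable_add integrable_mult_right int P P')+
    also have "\<dots> = p * fwd_avg k (?R ?P 0) z - c * (x * fwd_avg k (?R ?P1 0) z)"
      using int[OF P(1)] int[OF P(2)] by (simp add: fwd_avg_def mult.assoc)
    finally show ?thesis by (simp add: x_def)
  qed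
  have im: "integrable m h" if "continuous_on UNIV h" for h :: "'a \<Rightarrow> real"
    by (rule integrable_continuous_compact[OF G m(1) that])
  have c1: "continuous_on UNIV (chain_exp (k # ks) f ?P 0)" "continuous_on UNIV (chain_exp (k # ks) f ?P1 0)"
    by (intro continuous_chain_exp_section Cons.prems(1,2) P)+
  note cQ = continuous_fwd_avg[OF k cR(1)] continuous_fwd_avg[OF k cR(2)]
  have "(\<integral>z. p * chain_exp (k # ks) f ?P 0 z - c * (f z * chain_exp (k # ks) f ?P1 0 z) \<partial>m)
      \<le> (\<integral>z. p * fwd_avg k (?R ?P 0) z - c * (f z * fwd_avg k (?R ?P1 0) z) \<partial>m)"
    by (intro integral_mono im step continuous_intros c1 cQ Cons.prems(2))
  also have "\<dots> = p * (\<integral>z. fwd_avg k (?R ?P 0) z \<partial>m) - c * (\<integral>z. f z * fwd_avg k (?R ?P1 0) z \<partial>m)"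
    by (subst Bochner_Integration.integral_diff)
      (auto intro!: im continuous_intros cQ Cons.prems(2))
  \<comment> \<open>The functional is linear in the martingale value, so adjointness moves the
    average from the maximum to \<open>f\<close>. This replaces \<open>f\<close> by its conditional
    expectation \<open>bwd_avg k f\<close> and leaves the functional of the induction
    hypothesis.\<close>
  also have "\<dots> = p * (\<integral>z. ?R ?P 0 z \<partial>m) - c * (\<integral>z. ?f z * ?R ?P1 0 z \<partial>m)"
    by (simp add: integral_fwd_avg[OF m k cR(1)] integral_fwd_avg_mult[OF m k cR(2) Cons.prems(2)])
  also have "\<dots> = (\<integral>z. p * ?R ?P 0 z - c * (?f z * ?R ?P1 0 z) \<partial>m)"
    by (subst Bochner_Integration.integral_diff)
      (auto intro!: im continuous_intros cR cf)
  also have "\<dots> \<le> 0" unfolding c_def by (rule Cons.IH[OF ks cf f0])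
  finally show ?case unfolding c_def .
qed

text \<open>Jensen's inequality: the tangent to y^p at \<open>t z\<close> is integrated along the
  chain, using that the expected maximum is at least \<open>t z\<close>.\<close>

lemma chain_maps_powr_le:
  fixes f :: "'a \<Rightarrow> real"
  assumes p: "p > 1" and ks: "set ks \<subseteq> borel_probs" and f: "continuous_on UNIV f"
    and t: "t \<in> chain_maps ks f" and t0: "t z \<ge> 0"
  shows "t z powr p \<le> chain_exp ks f (\<lambda>y. \<bar>y\<bar> powr p) 0 z"
proof -
  let ?P = "\<lambda>y :: real. \<bar>y\<bar> powr p"
  let ?s = "t z"
  have P: "continuous_on UNIV ?P" using p by (auto intro: continuous_abs_powr)
  have id: "continuous_on UNIV (\<lambda>y :: real. y)" "continuous_on UNIV (\<lambda>y :: real. 1 :: real)" by (intro continuous_intros)+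
  have "p * ?s powr p = p * ?s powr (p - 1) * ?s"
    using t0 by (cases "?s = 0") (auto simp: powr_mult_base mult.assoc mult.commute)
  also have "\<dots> \<le> p * ?s powr (p - 1) * chain_exp ks f (\<lambda>y. y) 0 z"
    using p chain_maps_le_chain_exp[OF ks f t] by (intro mult_left_mono) auto
  also have "\<dots> = chain_exp ks f (\<lambda>y. (p * ?s powr (p - 1)) * y + 0 * 1) 0 z"
    by (subst chain_exp_lin[OF ks f id]) simp
  also have "\<dots> \<le> chain_exp ks f (\<lambda>y. ((p - 1) * ?s powr p) * 1 + 1 * ?P y) 0 z"
  proof (intro chain_exp_mono ks f)
    fix y :: real assume "y \<ge> 0"
    then show "(p * ?s powr (p - 1)) * y + 0 * 1 \<le> ((p - 1) * ?s powr p) * 1 + 1 * ?P y"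
      using Young_powr[OF p _ t0, of y] by (simp add: mult_ac)
  qed (auto intro!: continuous_intros P)
  also have "\<dots> = (p - 1) * ?s powr p + chain_exp ks f ?P 0 z"
    by (subst chain_exp_lin[OF ks f id(2) P]) (simp add: chain_exp_const[OF ks])
  finally show ?thesis by (simp add: algebra_simps)
qed

text \<open>Put q = p/(p-1), let x be the value of \<open>f\<close> and y the running maximum. Since
  p q = p^2/(p-1) is the coefficient in Burkholder's function, \<open>Young_powr\<close> at q x and
  y bounds y^p by (q x)^p plus that function, whose integral is nonpositive.\<close>

lemma Doob_chain_exp:
  fixes f :: "'a \<Rightarrow> real"
  assumes p: "p > 1" and m: "m \<in> borel_probs" "\<And>a. distr m borel (\<lambda>x. a + x) = m"
    and ks: "set ks \<subseteq> borel_probs" and f: "continuous_on UNIV f" "\<And>x. f x \<ge> 0"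
  shows "(\<integral>z. chain_exp ks f (\<lambda>y. \<bar>y\<bar> powr p) 0 z \<partial>m) \<le> (p / (p - 1)) powr p * (\<integral>z. f z powr p \<partial>m)"
proof -
  let ?P = "\<lambda>y :: real. \<bar>y\<bar> powr p"
  let ?P1 = "\<lambda>y :: real. \<bar>y\<bar> powr (p - 1)"
  define q where "q = p / (p - 1)"
  have q: "q > 0" using p by (simp add: q_def)
  have P: "continuous_on UNIV ?P" "continuous_on UNIV ?P1"
    using p by (auto intro: continuous_abs_powr)
  have im: "integrable m h" if "continuous_on UNIV h" for h :: "'a \<Rightarrow> real"
    by (rule integrable_continuous_compact[OF G m(1) that])
  note cR = continuous_chain_exp_section[OF ks f(1) P(1)] continuous_chain_exp_section[OF ks f(1) P(2)]
  have fp: "continuous_on UNIV (\<lambda>z. f z powr p)" 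
    by (rule continuous_on_powr'[OF f(1) continuous_on_const]) (use p f in auto)
  have "chain_exp ks f ?P 0 z \<le> q powr p * f z powr p
      + (p * chain_exp ks f ?P 0 z - p\<^sup>2 / (p - 1) * (f z * chain_exp ks f ?P1 0 z))" for z
  proof -
    have "chain_exp ks f (\<lambda>y. (p * (q * f z)) * ?P1 y + 0 * 1) 0 z
        \<le> chain_exp ks f (\<lambda>y. (p - 1) * ?P y + (q * f z) powr p * 1) 0 z"
    proof (rule chain_exp_mono[OF ks f(1)])
      fix y :: real assume y: "y \<ge> 0"
      show "p * (q * f z) * ?P1 y + 0 * 1 \<le> (p - 1) * ?P y + (q * f z) powr p * 1"
        using Young_powr[OF p _ y, of "q * f z"] q f(2)[of z] y by simp
    qed (auto intro!: continuous_on_add continuous_on_mult continuous_on_const P)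
    then have "p * (q * f z) * chain_exp ks f ?P1 0 z \<le> (p - 1) * chain_exp ks f ?P 0 z + (q * f z) powr p"
      by (simp only: chain_exp_lin[OF ks f(1) P(2) continuous_on_const]
          chain_exp_lin[OF ks f(1) P(1) continuous_on_const] chain_exp_const[OF ks])
    moreover have "p * (q * f z) = p\<^sup>2 / (p - 1) * f z"
      using p by (simp add: q_def power2_eq_square)
    ultimately show ?thesis using q f(2)[of z] by (simp add: powr_mult algebra_simps)
  qed
  note le = this
  have c1: "continuous_on UNIV (\<lambda>z. p * chain_exp ks f ?P 0 z
      - p\<^sup>2 / (p - 1) * (f z * chain_exp ks f ?P1 0 z))"
    by (intro continuous_on_diff continuous_on_mult continuous_on_const cR f(1))
  have c2: "continuous_on UNIV (\<lambda>z. q powr p * f z powr p)"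
    by (intro continuous_on_mult continuous_on_const fp)
  have "(\<integral>z. chain_exp ks f ?P 0 z \<partial>m) \<le> (\<integral>z. q powr p * f z powr p
      + (p * chain_exp ks f ?P 0 z - p\<^sup>2 / (p - 1) * (f z * chain_exp ks f ?P1 0 z)) \<partial>m)"
    by (rule integral_mono[OF im[OF cR(1)] im[OF continuous_on_add[OF c2 c1]] le])
  also have "\<dots> = q powr p * (\<integral>z. f z powr p \<partial>m)
      + (\<integral>z. p * chain_exp ks f ?P 0 z - p\<^sup>2 / (p - 1) * (f z * chain_exp ks f ?P1 0 z) \<partial>m)"
    by (subst Bochner_Integration.integral_add[OF im[OF c2] im[OF c1]]) simp
  also have "\<dots> \<le> q powr p * (\<integral>z. f z powr p \<partial>m)"
    using Doob_functional_nonpos[OF p m ks f] by simp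
  finally show ?thesis unfolding q_def .
qed

end

section \<open>\<open>L\<^sup>p\<close> norms of extended nonnegative functions\<close>

lemma enn_powr_ennreal: "r \<ge> 0 \<Longrightarrow> enn_powr (ennreal r) a = ennreal (r powr a)"
  by (simp add: enn_powr_def)

lemma enn_powr_top [simp]: "enn_powr \<infinity> a = \<infinity>" "enn_powr top a = top"
  by (simp_all add: enn_powr_def)

lemma enn_powr_0 [simp]: "enn_powr 0 a = 0"
  by (simp add: enn_powr_def)

lemma enn_powr_mono: "a \<ge> 0 \<Longrightarrow> x \<le> y \<Longrightarrow> enn_powr x a \<le> enn_powr y a"
  by (cases x; cases y) (auto simp: enn_powr_ennreal top_unique intro: powr_mono2)

lemma enn_powr_powr: "a > 0 \<Longrightarrow> b > 0 \<Longrightarrow> enn_powr (enn_powr x a) b = enn_powr x (a * b)"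
  by (cases x) (auto simp: enn_powr_ennreal powr_powr)

lemma enn_powr_1 [simp]: "enn_powr x 1 = x"
  by (cases x) (auto simp: enn_powr_ennreal)

text \<open>A Galois connection between the powers 1/a and a. It yields the preservation of suprema
  and turns bounds on \<open>Lp_norm\<close> into bounds on integrals.\<close>

lemma enn_powr_le_iff:
  assumes "a > 0"
  shows "enn_powr x (1 / a) \<le> y \<longleftrightarrow> x \<le> enn_powr y a"
proof
  assume "enn_powr x (1 / a) \<le> y"
  then have "enn_powr (enn_powr x (1 / a)) a \<le> enn_powr y a"
    using assms by (intro enn_powr_mono) auto
  then show "x \<le> enn_powr y a" using assms by (simp add: enn_powr_powr)
next
  assume "x \<le> enn_powr y a"
  then have "enn_powr x (1 / a) \<le> enn_powr (enn_powr y a) (1 / a)"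
    using assms by (intro enn_powr_mono) auto
  then show "enn_powr x (1 / a) \<le> y" using assms by (simp add: enn_powr_powr)
qed

lemma enn_powr_mult: "a > 0 \<Longrightarrow> enn_powr (x * y) a = enn_powr x a * enn_powr y a"
  by (cases x; cases y)
    (auto simp: enn_powr_ennreal powr_mult ennreal_mult_top ennreal_top_mult simp flip: ennreal_mult)

lemma enn_powr_SUP:
  assumes "a > 0"
  shows "enn_powr (SUP i\<in>I. f i) a = (SUP i\<in>I. enn_powr (f i) a)"
proof (rule antisym)
  have *: "enn_powr x a \<le> y \<longleftrightarrow> x \<le> enn_powr y (1 / a)" for x y
    using enn_powr_le_iff[of "1 / a" x y] assms by simp
  show "enn_powr (SUP i\<in>I. f i) a \<le> (SUP i\<in>I. enn_powr (f i) a)"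
    unfolding * by (rule SUP_least) (auto simp: *[symmetric] intro: SUP_upper)
  show "(SUP i\<in>I. enn_powr (f i) a) \<le> enn_powr (SUP i\<in>I. f i) a"
    using assms by (auto intro!: SUP_least enn_powr_mono SUP_upper)
qed

lemma enn_powr_eq_0_iff: "enn_powr x a = 0 \<longleftrightarrow> x = 0"
  by (cases x) (auto simp: enn_powr_ennreal)

lemma enn_powr_less_top_iff: "enn_powr x a < \<infinity> \<longleftrightarrow> x < \<infinity>"
  by (cases x) (auto simp: enn_powr_ennreal)

lemma measurable_enn_powr [measurable]: "(\<lambda>x. enn_powr x a) \<in> borel_measurable borel"
  unfolding enn_powr_def by measurable

lemma enn_powr_tendsto_0:
  assumes "a > 0" and "(u \<longlongrightarrow> 0) F"
  shows "((\<lambda>n. enn_powr (u n) a) \<longlongrightarrow> 0) F"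
proof (rule order_tendstoI)
  fix e :: ennreal assume "0 < e"
  then obtain d where d: "0 < d" "d < e" using dense by blast
  then have "0 < enn_powr d (1 / a)" by (simp add: enn_powr_eq_0_iff zero_less_iff_neq_zero)
  from order_tendstoD(2)[OF assms(2) this]
  show "\<forall>\<^sub>F n in F. enn_powr (u n) a < e"
  proof eventually_elim
    case (elim n)
    then have "enn_powr (u n) a \<le> d"
      using enn_powr_le_iff[of "1 / a" "u n" d] assms(1) by simp
    with d(2) show ?case by simp
  qed
qed simp

text \<open>Convexity of the power at u + v = t (u/t) + (1-t) (v/(1-t)), derived from the tangent at
  u + v. Integrated with the best choice of \<open>t\<close> it becomes Minkowski's
  inequality.\<close>

lemma powr_convex_bound:
  fixes u v t :: real
  assumes p: "p > 1" and u: "u \<ge> 0" and v: "v \<ge> 0" and t: "0 < t" "t < 1"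
  shows "(u + v) powr p \<le> t powr (1 - p) * u powr p + (1 - t) powr (1 - p) * v powr p"
proof -
  let ?c = "u + v"
  have e: "s * (w / s) powr p = s powr (1 - p) * w powr p" if "s > 0" "w \<ge> 0" for s w :: real
    using that by (simp add: powr_divide powr_diff)
  have cc: "?c * ?c powr (p - 1) = ?c powr p"
    using u v by (cases "?c = 0") (auto simp: powr_mult_base)
  have "t * (p * (u / t) * ?c powr (p - 1)) \<le> t * ((p - 1) * ?c powr p + (u / t) powr p)"
    using t u v by (intro mult_left_mono Young_powr p) auto
  moreover have "(1 - t) * (p * (v / (1 - t)) * ?c powr (p - 1))
      \<le> (1 - t) * ((p - 1) * ?c powr p + (v / (1 - t)) powr p)"
    using t u v by (intro mult_left_mono Young_powr p) auto
  moreover have "t * (p * (u / t) * ?c powr (p - 1)) = p * u * ?c powr (p - 1)"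
    "(1 - t) * (p * (v / (1 - t)) * ?c powr (p - 1)) = p * v * ?c powr (p - 1)"
    using t by simp_all
  ultimately have "p * (?c * ?c powr (p - 1)) \<le> (p - 1) * ?c powr p
      + t * (u / t) powr p + (1 - t) * (v / (1 - t)) powr p"
    by (simp only:) (simp add: algebra_simps)
  then have "?c powr p \<le> t * (u / t) powr p + (1 - t) * (v / (1 - t)) powr p"
    unfolding cc by (simp add: algebra_simps)
  then show ?thesis using e[of t u] e[of "1 - t" v] t u v by simp
qed

lemma Lp_norm_le_iff: "p > 0 \<Longrightarrow> Lp_norm p M F \<le> c \<longleftrightarrow> (\<integral>\<^sup>+x. enn_powr (F x) p \<partial>M) \<le> enn_powr c p"
  unfolding Lp_norm_def by (rule enn_powr_le_iff)

lemma Lp_norm_mono: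
  assumes "p > 0" "\<And>x. x \<in> space M \<Longrightarrow> F x \<le> H x"
  shows "Lp_norm p M F \<le> Lp_norm p M H"
  unfolding Lp_norm_def using assms by (intro enn_powr_mono nn_integral_mono) auto

lemma enn_powr_Lp_norm: "p > 0 \<Longrightarrow> enn_powr (Lp_norm p M F) p = (\<integral>\<^sup>+x. enn_powr (F x) p \<partial>M)"
  by (simp add: Lp_norm_def enn_powr_powr)

lemma Lp_norm_triangle:
  assumes p: "p > 1" and [measurable]: "F \<in> borel_measurable M" "H \<in> borel_measurable M"
  shows "Lp_norm p M (\<lambda>x. F x + H x) \<le> Lp_norm p M F + Lp_norm p M H"
proof (rule ennreal_le_epsilon)
  fix e :: real
  assume fin: "Lp_norm p M F + Lp_norm p M H < top" and e: "e > 0"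
  \<comment> \<open>The surplus e/2 keeps both numbers positive even if a norm vanishes, so that
    \<open>t\<close> lies strictly between 0 and 1.\<close>
  define A where "A = enn2real (Lp_norm p M F) + e / 2"
  define B where "B = enn2real (Lp_norm p M H) + e / 2"
  have AB: "A > 0" "B > 0" using e by (auto simp: A_def B_def add_nonneg_pos)
  have A: "Lp_norm p M F \<le> ennreal A" "Lp_norm p M H \<le> ennreal B"
    unfolding A_def B_def using fin e by (auto simp: ennreal_plus less_top intro: add_increasing2)
  \<comment> \<open>The minimiser of the integrated convexity bound: with this weight the right-hand
    side is exactly (A + B)^p.\<close>
  define t where "t = A / (A + B)"
  have t: "0 < t" "t < 1" "1 - t = B / (A + B)" using AB by (auto simp: t_def field_simps)
  have pw: "enn_powr (a + b) p \<le> ennreal (t powr (1 - p)) * enn_powr a p + ennreal ((1 - t) powr (1 - p)) * enn_powr b p"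
    for a b :: ennreal
  proof (cases "a = top \<or> b = top")
    case True
    then show ?thesis using t by (auto simp: ennreal_mult_top)
  next
    case False
    then obtain u v where "a = ennreal u" "u \<ge> 0" "b = ennreal v" "v \<ge> 0"
      by (cases a; cases b) auto
    then show ?thesis
      using powr_convex_bound[OF p, of u v t] t
      by (simp add: enn_powr_ennreal flip: ennreal_mult ennreal_plus)
  qed
  have c: "t powr (1 - p) * A powr p + (1 - t) powr (1 - p) * B powr p = (A + B) powr p"
  proof -
    have "(c / (A + B)) powr (1 - p) * c powr p = c * (A + B) powr (p - 1)" if "c > 0" for c
    proof -
      have "(c / (A + B)) powr (1 - p) * c powr p = c powr (1 - p) * c powr p / (A + B) powr (1 - p)"
        using that AB by (simp add: powr_divide)
      also have "c powr (1 - p) * c powr p = c" using that by (simp flip: powr_add)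
      also have "c / (A + B) powr (1 - p) = c * (A + B) powr (p - 1)"
        using powr_minus_divide[of "A + B" "1 - p"] by simp
      finally show ?thesis .
    qed
    then have "t powr (1 - p) * A powr p + (1 - t) powr (1 - p) * B powr p = (A + B) * (A + B) powr (p - 1)"
      unfolding t(3) using AB by (simp add: t_def distrib_right)
    then show ?thesis using AB by (simp add: powr_mult_base)
  qed
  have "(\<integral>\<^sup>+x. enn_powr (F x + H x) p \<partial>M) \<le> (\<integral>\<^sup>+x. ennreal (t powr (1 - p)) * enn_powr (F x) p
      + ennreal ((1 - t) powr (1 - p)) * enn_powr (H x) p \<partial>M)"
    by (intro nn_integral_mono pw)
  also have "\<dots> = ennreal (t powr (1 - p)) * (\<integral>\<^sup>+x. enn_powr (F x) p \<partial>M)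
      + ennreal ((1 - t) powr (1 - p)) * (\<integral>\<^sup>+x. enn_powr (H x) p \<partial>M)"
    by (simp add: nn_integral_add nn_integral_cmult)
  also have "\<dots> \<le> ennreal (t powr (1 - p)) * enn_powr (ennreal A) p
      + ennreal ((1 - t) powr (1 - p)) * enn_powr (ennreal B) p"
    using A p by (intro add_mono mult_left_mono) (auto simp: Lp_norm_le_iff)
  also have "\<dots> = enn_powr (ennreal (A + B)) p"
    using AB c by (simp add: enn_powr_ennreal flip: ennreal_mult ennreal_plus)
  finally have "Lp_norm p M (\<lambda>x. F x + H x) \<le> ennreal (A + B)"
    using p by (simp add: Lp_norm_le_iff)
  also have "\<dots> = Lp_norm p M F + Lp_norm p M H + ennreal e"
    unfolding A_def B_def using fin e by (simp add: ennreal_plus less_top add_ac flip: ennreal_plus)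
      (simp add: ennreal_plus)
  finally show "Lp_norm p M (\<lambda>x. F x + H x) \<le> Lp_norm p M F + Lp_norm p M H + ennreal e" .
qed

lemma Lp_norm_sum:
  assumes p: "p > 1" and "finite I" "\<And>i. i \<in> I \<Longrightarrow> F i \<in> borel_measurable M"
  shows "Lp_norm p M (\<lambda>x. \<Sum>i\<in>I. F i x) \<le> (\<Sum>i\<in>I. Lp_norm p M (F i))"
  using assms(2,3)
proof (induction I)
  case empty
  then show ?case by (simp add: Lp_norm_def)
next
  case (insert i I)
  have "Lp_norm p M (\<lambda>x. F i x + (\<Sum>i\<in>I. F i x)) \<le> Lp_norm p M (F i) + Lp_norm p M (\<lambda>x. \<Sum>i\<in>I. F i x)"
    using insert by (intro Lp_norm_triangle p) auto
  also have "\<dots> \<le> Lp_norm p M (F i) + (\<Sum>i\<in>I. Lp_norm p M (F i))"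
    using insert by (intro add_left_mono insert.IH) auto
  finally show ?case using insert by simp
qed

lemma Lp_norm_SUP:
  assumes p: "p > 0" and F: "\<And>n :: nat. F n \<in> borel_measurable M" "incseq F"
  shows "Lp_norm p M (\<lambda>x. SUP n. F n x) = (SUP n. Lp_norm p M (F n))"
proof -
  have "(\<integral>\<^sup>+x. enn_powr (SUP n. F n x) p \<partial>M) = (\<integral>\<^sup>+x. (SUP n. enn_powr (F n x) p) \<partial>M)"
    using p by (simp add: enn_powr_SUP)
  also have "\<dots> = (SUP n. \<integral>\<^sup>+x. enn_powr (F n x) p \<partial>M)"
  proof (rule nn_integral_monotone_convergence_SUP)
    show "incseq (\<lambda>n x. enn_powr (F n x) p)"
      using F(2) p by (auto simp: incseq_def le_fun_def intro!: enn_powr_mono)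
  qed (use F(1) in measurable)
  finally show ?thesis using p by (simp add: Lp_norm_def enn_powr_SUP)
qed

text \<open>The tangent at the mean is integrated. If the mean is infinite, the tangent at 1 already
  forces the right-hand side to be infinite.\<close>

lemma nn_integral_enn_powr_Jensen:
  assumes "prob_space N" and p: "p > 1" and [measurable]: "h \<in> borel_measurable N"
  shows "enn_powr (\<integral>\<^sup>+x. h x \<partial>N) p \<le> (\<integral>\<^sup>+x. enn_powr (h x) p \<partial>N)"
proof -
  interpret prob_space N by fact
  have Young: "ennreal (p * t powr (p - 1)) * a \<le> ennreal ((p - 1) * t powr p) + enn_powr a p"
    if "t \<ge> 0" for a :: ennreal and t
  proof (cases a)
    case (real r)
    then show ?thesis using Young_powr[OF p, of r t] that p
      by (simp add: enn_powr_ennreal mult_ac flip: ennreal_mult ennreal_plus)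
  qed simp
  have int: "ennreal (p * t powr (p - 1)) * (\<integral>\<^sup>+x. h x \<partial>N)
      \<le> ennreal ((p - 1) * t powr p) + (\<integral>\<^sup>+x. enn_powr (h x) p \<partial>N)" if t: "t \<ge> 0" for t
  proof -
    have "(\<integral>\<^sup>+x. ennreal (p * t powr (p - 1)) * h x \<partial>N)
        \<le> (\<integral>\<^sup>+x. ennreal ((p - 1) * t powr p) + enn_powr (h x) p \<partial>N)"
      by (intro nn_integral_mono Young t)
    then show ?thesis by (simp add: nn_integral_cmult nn_integral_add emeasure_space_1)
  qed
  show ?thesis
  proof (cases "\<integral>\<^sup>+x. h x \<partial>N")
    case (real t)
    have "p * t powr (p - 1) * t = (p - 1) * t powr p + t powr p"
      using real(1) by (cases "t = 0") (auto simp: powr_mult_base algebra_simps)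
    then have "ennreal ((p - 1) * t powr p) + ennreal (t powr p)
        \<le> ennreal ((p - 1) * t powr p) + (\<integral>\<^sup>+x. enn_powr (h x) p \<partial>N)"
      using int[OF real(1)] real p by (simp flip: ennreal_mult ennreal_plus)
    then show ?thesis using real by (simp add: enn_powr_ennreal)
  next
    case top
    have "(\<integral>\<^sup>+x. enn_powr (h x) p \<partial>N) = top"
      using int[of 1] top p by (simp add: ennreal_mult_top top_unique)
    then show ?thesis by simp
  qed
qed

section \<open>Convolution\<close>

lemma regular_borel_probD:
  assumes "regular_borel_prob N"
  shows "N \<in> borel_probs" "prob_space N" "sets N = sets borel" "space N = UNIV"
proof -
  show *: "prob_space N" "sets N = sets borel" using assms by (auto simp: regular_borel_prob_def)
  then show "N \<in> borel_probs" by (simp add: space_prob_algebra)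
  then show "space N = UNIV" by (rule borel_probsD(3))
qed

lemma regular_borel_prob_inner:
  assumes "regular_borel_prob N" "A \<in> sets borel" "a < emeasure N A"
  obtains K where "K \<subseteq> A" "compact K" "a < emeasure N K"
proof -
  have "emeasure N A = (SUP K\<in>{K. K \<subseteq> A \<and> compact K}. emeasure N K)"
    using assms(1,2) by (auto simp: regular_borel_prob_def)
  with assms(3) show thesis using that by (auto simp: less_SUP_iff)
qed

lemma regular_borel_prob_outer:
  assumes "regular_borel_prob N" "A \<in> sets borel" "emeasure N A < a"
  obtains U where "A \<subseteq> U" "open U" "emeasure N U < a"
proof -
  have "emeasure N A = (INF U\<in>{U. A \<subseteq> U \<and> open U}. emeasure N U)"
    using assms(1,2) unfolding regular_borel_prob_def by blast
  with assms(3) show thesis using that by (auto simp: INF_less_iff)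
qed

section \<open>Translation kernels and integrals against convolutions\<close>

lemma measurable_add_const [measurable]:
  "(\<lambda>y :: 'a::topological_ab_group_add. x + y) \<in> borel \<rightarrow>\<^sub>M borel"
  by (intro borel_measurable_continuous_onI continuous_intros)

lemma measurable_diff_const [measurable]:
  "(\<lambda>y :: 'a::topological_ab_group_add. x - y) \<in> borel \<rightarrow>\<^sub>M borel"
  by (intro borel_measurable_continuous_onI continuous_intros)

lemma measurable_uminus_group [measurable]:
  "(\<lambda>y :: 'a::topological_ab_group_add. - y) \<in> borel \<rightarrow>\<^sub>M borel"
  by (intro borel_measurable_continuous_onI continuous_intros)

lemma measurable_add_prod:
  "(\<lambda>(x, y). x + y) \<in> (borel :: ('a::topological_ab_group_add \<times> 'a) measure) \<rightarrow>\<^sub>M borel"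
  unfolding case_prod_unfold by (intro borel_measurable_continuous_onI continuous_intros)

text \<open>The law of x + Y for Y of law \<open>N\<close>. As a kernel in x it presents a
  convolution as a monadic bind, whose integral formulas do not involve addition on the product
  sigma-algebra.\<close>

definition translates :: "'a::topological_ab_group_add measure \<Rightarrow> 'a \<Rightarrow> 'a measure" where
  "translates N x = distr N borel (\<lambda>y. x + y)"

text \<open>The preimage of a Borel set under addition is Borel for the product topology, and its
  sections have measurable mass by \<open>borel_measurable_emeasure_section\<close>. Regularity of
  \<open>N\<close> enters there.\<close>

lemma translates_kernel:
  fixes N :: "'a::topological_ab_group_add measure"
  assumes N: "regular_borel_prob N"
  shows "translates N \<in> borel \<rightarrow>\<^sub>M subprob_algebra borel"
proof (rule measurable_subprob_algebra)
  note [simp, measurable_cong] = regular_borel_probD(3)[OF N]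
  interpret prob_space N by (rule regular_borel_probD(2)[OF N])
  show "subprob_space (translates N x)" for x
    unfolding translates_def by (intro prob_space_imp_subprob_space prob_space_distr) simp
  show "sets (translates N x) = sets borel" for x by (simp add: translates_def)
  show "(\<lambda>x. emeasure (translates N x) A) \<in> borel_measurable borel" if A: "A \<in> sets borel" for A
  proof -
    have E: "(\<lambda>(x, y). x + y) -` A \<in> sets (borel :: ('a \<times> 'a) measure)"
      using measurable_sets[OF measurable_add_prod A] by simp
    have "emeasure (translates N x) A = emeasure N (Pair x -` ((\<lambda>(x, y). x + y) -` A))" for x
      using A by (simp add: translates_def emeasure_distr regular_borel_probD(4)[OF N] vimage_def)
    then show ?thesis using borel_measurable_emeasure_section[OF N E] by simp
  qed
qed

lemma sets_measure_conv [simp]: "sets (measure_conv M N) = sets borel"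
  by (simp add: measure_conv_def)

lemma measure_conv_eq_bind:
  fixes M N :: "'a::topological_ab_group_add measure"
  assumes M: "M \<in> borel_probs" and N: "regular_borel_prob N"
  shows "measure_conv M N = M \<bind> translates N"
proof (rule measure_eqI)
  have sM: "sets M = sets borel" by (rule borel_probsD(2)[OF M])
  have k: "translates N \<in> M \<rightarrow>\<^sub>M subprob_algebra borel"
    using translates_kernel[OF N] sM by (simp cong: measurable_cong_sets)
  have ne: "space M \<noteq> {}" using borel_probsD(3)[OF M] by simp
  show "sets (measure_conv M N) = sets (M \<bind> translates N)"
    using sets_bind[OF sets_kernel[OF k] ne] by simp
  fix A assume "A \<in> sets (measure_conv M N)"
  then have A: "A \<in> sets borel" by simp
  have E: "(\<lambda>(x, y). x + y) -` A \<in> sets (borel :: ('a \<times> 'a) measure)"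
    using measurable_sets[OF measurable_add_prod A] by simp
  have sN: "sets N = sets borel" by (rule regular_borel_probD(3)[OF N])
  have meas: "(\<lambda>y. x + y) \<in> N \<rightarrow>\<^sub>M borel" for x
    using measurable_add_const by (simp add: sN cong: measurable_cong_sets)
  have "emeasure (measure_conv M N) A = emeasure (borel_product M N) ((\<lambda>(x, y). x + y) -` A)"
  proof -
    have sp: "space (borel_product M N) = UNIV"
      using sets_eq_imp_space_eq[OF sets_borel_product[of M N]] by simp
    have "(\<lambda>(x, y). x + y) \<in> borel_product M N \<rightarrow>\<^sub>M borel"
      using measurable_add_prod by (simp add: sets_borel_product cong: measurable_cong_sets)
    from emeasure_distr[OF this A] show ?thesis by (simp add: measure_conv_def sp)
  qed
  also have "\<dots> = (\<integral>\<^sup>+x. emeasure N (Pair x -` ((\<lambda>(x, y). x + y) -` A)) \<partial>M)"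
    by (rule emeasure_borel_product[OF sM N E])
  also have "\<dots> = (\<integral>\<^sup>+x. emeasure (translates N x) A \<partial>M)"
    using A meas by (simp add: translates_def emeasure_distr regular_borel_probD(4)[OF N] vimage_def)
  also have "\<dots> = emeasure (M \<bind> translates N) A"
    using emeasure_bind[OF ne k A] by simp
  finally show "emeasure (measure_conv M N) A = emeasure (M \<bind> translates N) A" .
qed

lemma emeasure_measure_conv:
  fixes M N :: "'a::topological_ab_group_add measure"
  assumes M: "M \<in> borel_probs" and N: "regular_borel_prob N" and A: "A \<in> sets borel"
  shows "emeasure (measure_conv M N) A = (\<integral>\<^sup>+x. emeasure (translates N x) A \<partial>M)"
proof -
  have "translates N \<in> M \<rightarrow>\<^sub>M subprob_algebra borel"
    using translates_kernel[OF N] borel_probsD(2)[OF M] by (simp cong: measurable_cong_sets)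
  then show ?thesis
    using borel_probsD(3)[OF M] by (simp add: measure_conv_eq_bind[OF M N] emeasure_bind[OF _ _ A])
qed

definition nn_avg :: "'a::topological_ab_group_add measure \<Rightarrow> ('a \<Rightarrow> ennreal) \<Rightarrow> 'a \<Rightarrow> ennreal" where
  "nn_avg N h x = (\<integral>\<^sup>+y. h (x + y) \<partial>N)"

lemma nn_integral_translates:
  assumes "N \<in> borel_probs" "h \<in> borel_measurable borel"
  shows "(\<integral>\<^sup>+y. h y \<partial>translates N x) = nn_avg N h x"
proof -
  have "(\<lambda>y. x + y) \<in> N \<rightarrow>\<^sub>M borel"
    using measurable_add_const by (simp add: borel_probsD(2)[OF assms(1)] cong: measurable_cong_sets)
  then show ?thesis
    using assms(2) by (simp add: translates_def nn_avg_def nn_integral_distr)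
qed

lemma borel_measurable_nn_avg:
  assumes N: "regular_borel_prob N" and h: "h \<in> borel_measurable borel"
  shows "nn_avg N h \<in> borel_measurable borel"
proof -
  have "(\<lambda>x. \<integral>\<^sup>+y. h y \<partial>translates N x) \<in> borel_measurable borel"
    by (rule measurable_compose[OF translates_kernel[OF N] nn_integral_measurable_subprob_algebra[OF h]])
  then show ?thesis by (simp add: nn_integral_translates[OF regular_borel_probD(1)[OF N] h])
qed

lemma nn_integral_measure_conv:
  assumes M: "M \<in> borel_probs" and N: "regular_borel_prob N" and h: "h \<in> borel_measurable borel"
  shows "(\<integral>\<^sup>+y. h y \<partial>measure_conv M N) = (\<integral>\<^sup>+x. nn_avg N h x \<partial>M)"
proof -
  have k: "translates N \<in> M \<rightarrow>\<^sub>M subprob_algebra borel"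
    using translates_kernel[OF N] borel_probsD(2)[OF M] by (simp cong: measurable_cong_sets)
  show ?thesis
    unfolding measure_conv_eq_bind[OF M N] nn_integral_bind[OF h k]
    by (simp add: nn_integral_translates[OF regular_borel_probD(1)[OF N] h])
qed

lemma measure_conv_borel_probs:
  assumes M: "M \<in> borel_probs" and N: "regular_borel_prob N"
  shows "measure_conv M N \<in> borel_probs"
proof -
  have N1: "emeasure N UNIV = 1" "emeasure M UNIV = 1"
    using prob_space.emeasure_space_1[of N] prob_space.emeasure_space_1[of M] regular_borel_probD[OF N] borel_probsD[OF M] by auto
  have "emeasure (measure_conv M N) UNIV = (\<integral>\<^sup>+y. 1 \<partial>measure_conv M N)"
    by (simp add: measure_conv_def)
  also have "\<dots> = (\<integral>\<^sup>+x. nn_avg N (\<lambda>_. 1) x \<partial>M)" by (rule nn_integral_measure_conv[OF M N]) simp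
  also have "\<dots> = 1" using N1 regular_borel_probD(4)[OF N] borel_probsD(3)[OF M] by (simp add: nn_avg_def)
  finally have "prob_space (measure_conv M N)"
    by (intro prob_spaceI) (simp add: measure_conv_def)
  then show ?thesis by (simp add: space_prob_algebra)
qed

lemma integral_measure_conv:
  fixes h :: "'a::topological_ab_group_add \<Rightarrow> real"
  assumes G: "compact (UNIV :: 'a set)"
    and M: "M \<in> borel_probs" and N: "regular_borel_prob N" and h: "continuous_on UNIV h"
  shows "(\<integral>y. h y \<partial>measure_conv M N) = (\<integral>x. fwd_avg N h x \<partial>M)"
proof -
  interpret M: prob_space M by (rule borel_probsD(1)[OF M])
  have k: "translates N \<in> M \<rightarrow>\<^sub>M subprob_algebra borel"
    using translates_kernel[OF N] borel_probsD(2)[OF M] by (simp cong: measurable_cong_sets)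
  obtain B where B: "\<And>x. \<bar>h x\<bar> \<le> B"
    using bounded_range_continuous[OF G h] by (auto simp: bounded_iff)
  have hm: "h \<in> borel_measurable borel" by (rule borel_measurable_continuous_onI[OF h])
  have meas: "(\<lambda>y. x + y) \<in> N \<rightarrow>\<^sub>M borel" for x
    using measurable_add_const by (simp add: regular_borel_probD(3)[OF N] cong: measurable_cong_sets)
  have "(\<integral>y. h y \<partial>measure_conv M N) = (\<integral>x. \<integral>y. h y \<partial>translates N x \<partial>M)"
    unfolding measure_conv_eq_bind[OF M N]
  proof (rule integral_bind[OF hm _ k])
    show "finite_measure M" by unfold_locales
    show "AE x in M. emeasure (translates N x) (space (translates N x)) \<le> ennreal 1"
      using subprob_space.emeasure_space_le_1[OF subprob_space_kernel[OF k]] by (auto intro: AE_I2)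
  qed (use B in auto)
  also have "\<dots> = (\<integral>x. fwd_avg N h x \<partial>M)"
    by (simp add: translates_def fwd_avg_def integral_distr[OF meas hm])
  finally show ?thesis .
qed

section \<open>Reflected measures and Urysohn functions\<close>

lemma regular_borel_prob_reflected:
  fixes N :: "'a::topological_ab_group_add measure"
  assumes N: "regular_borel_prob N"
  shows "regular_borel_prob (reflected N)"
proof -
  have sN: "sets N = sets borel" by (rule regular_borel_probD(3)[OF N])
  interpret prob_space N by (rule regular_borel_probD(2)[OF N])
  have meas: "(\<lambda>y. - y) \<in> N \<rightarrow>\<^sub>M borel"
    using measurable_uminus_group by (simp add: sN cong: measurable_cong_sets)
  have em: "emeasure (reflected N) A = emeasure N (uminus ` A)" if "A \<in> sets borel" for A
  proof -
    have "uminus -` A = uminus ` A" by (force simp: image_iff)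
    then show ?thesis
      using emeasure_distr[OF meas that] by (simp add: reflected_def regular_borel_probD(4)[OF N])
  qed
  have inv: "uminus ` uminus ` A = A" for A :: "'a set" by (force simp: image_iff)
  have bor: "uminus ` A \<in> sets borel" if "A \<in> sets borel" for A :: "'a set"
  proof -
    have "uminus -` A = uminus ` A" by (force simp: image_iff)
    then show ?thesis using measurable_sets[OF measurable_uminus_group that] by simp
  qed
  have comp: "compact (uminus ` K)" if "compact K" for K :: "'a set"
    by (rule compact_continuous_image[OF _ that]) (intro continuous_intros)
  have op: "open (uminus ` U)" if "open U" for U :: "'a set"
  proof -
    have "uminus -` U = uminus ` U" by (force simp: image_iff)
    moreover have "open (uminus -` U)" by (intro open_vimage that continuous_intros)
    ultimately show ?thesis by simp
  qed
  have prob: "prob_space (reflected N)" unfolding reflected_def by (rule prob_space_distr[OF meas])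
  have sets: "sets (reflected N) = sets borel" by (simp add: reflected_def)
  show ?thesis
    unfolding regular_borel_prob_def
  proof (intro conjI ballI prob sets)
    fix A :: "'a set" assume A: "A \<in> sets borel"
    show "emeasure (reflected N) A = (SUP K\<in>{K. K \<subseteq> A \<and> compact K}. emeasure (reflected N) K)"
    proof (rule antisym)
      show "emeasure (reflected N) A \<le> (SUP K\<in>{K. K \<subseteq> A \<and> compact K}. emeasure (reflected N) K)"
      proof (rule dense_le)
        fix a assume "a < emeasure (reflected N) A"
        then have "a < emeasure N (uminus ` A)" by (simp add: em A)
        then obtain K where K: "K \<subseteq> uminus ` A" "compact K" "a < emeasure N K"
          using regular_borel_prob_inner[OF N bor[OF A]] by metis
        have "emeasure N K = emeasure N (uminus ` uminus ` K)" by (simp only: inv)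
        also have "\<dots> \<le> emeasure (reflected N) (uminus ` K)"
        \<comment> \<open>The type is not assumed to be Hausdorff here, so a compact set may fail to
          be Borel. Its \<open>emeasure\<close> is then 0 by convention.\<close>
        proof (cases "uminus ` K \<in> sets borel")
          case True then show ?thesis by (simp add: em)
        next
          case False
          then have "K \<notin> sets borel" using bor[of K] by auto
          then show ?thesis by (simp add: inv emeasure_notin_sets sN)
        qed
        finally have "a < emeasure (reflected N) (uminus ` K)" using K(3) by simp
        moreover have "uminus ` K \<subseteq> A" using K(1) by (auto simp: subset_iff)
        ultimately show "a \<le> (SUP K\<in>{K. K \<subseteq> A \<and> compact K}. emeasure (reflected N) K)"
          using comp[OF K(2)] by (intro SUP_upper2[of "uminus ` K"]) auto
      qed
      show "(SUP K\<in>{K. K \<subseteq> A \<and> compact K}. emeasure (reflected N) K) \<le> emeasure (reflected N) A"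
        using A by (intro SUP_least emeasure_mono) (auto simp: sets)
    qed
    show "emeasure (reflected N) A = (INF U\<in>{U. A \<subseteq> U \<and> open U}. emeasure (reflected N) U)"
    proof (rule antisym)
      show "(INF U\<in>{U. A \<subseteq> U \<and> open U}. emeasure (reflected N) U) \<le> emeasure (reflected N) A"
      proof (rule dense_ge)
        fix a assume "emeasure (reflected N) A < a"
        then have "emeasure N (uminus ` A) < a" by (simp add: em A)
        then obtain U where U: "uminus ` A \<subseteq> U" "open U" "emeasure N U < a"
          using regular_borel_prob_outer[OF N bor[OF A]] by metis
        have "emeasure (reflected N) (uminus ` U) < a"
          using U(3) op[OF U(2)] by (simp add: em inv)
        moreover have "A \<subseteq> uminus ` U" using U(1) by (force simp: image_iff subset_iff)
        ultimately show "(INF U\<in>{U. A \<subseteq> U \<and> open U}. emeasure (reflected N) U) \<le> a"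
          using op[OF U(2)] by (intro INF_lower2[of "uminus ` U"]) auto
      qed
      show "emeasure (reflected N) A \<le> (INF U\<in>{U. A \<subseteq> U \<and> open U}. emeasure (reflected N) U)"
        by (intro INF_greatest emeasure_mono) (auto simp: sets)
    qed
  qed
qed

lemma nn_integral_reflected:
  assumes "N \<in> borel_probs" "h \<in> borel_measurable borel"
  shows "(\<integral>\<^sup>+y. h y \<partial>reflected N) = (\<integral>\<^sup>+y. h (- y) \<partial>N)"
proof -
  have "(\<lambda>y. - y) \<in> N \<rightarrow>\<^sub>M borel"
    using measurable_uminus_group by (simp add: borel_probsD(2)[OF assms(1)] cong: measurable_cong_sets)
  then show ?thesis using assms(2) by (simp add: reflected_def nn_integral_distr)
qed

lemma fwd_avg_reflected:
  assumes "N \<in> borel_probs" "continuous_on UNIV h"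
  shows "fwd_avg (reflected N) h x = bwd_avg N h x"
proof -
  have "(\<lambda>y. - y) \<in> N \<rightarrow>\<^sub>M borel"
    using measurable_uminus_group by (simp add: borel_probsD(2)[OF assms(1)] cong: measurable_cong_sets)
  moreover have "(\<lambda>y. h (x + y)) \<in> borel_measurable borel"
    by (rule measurable_compose[OF measurable_add_const borel_measurable_continuous_onI[OF assms(2)]])
  ultimately show ?thesis by (simp add: fwd_avg_def bwd_avg_def reflected_def integral_distr)
qed

lemma Urysohn_compact:
  fixes K U :: "'a::t2_space set"
  assumes G: "compact (UNIV :: 'a set)" and K: "compact K" and U: "open U" "K \<subseteq> U"
  obtains h :: "'a \<Rightarrow> real" where "continuous_on UNIV h" "\<And>x. 0 \<le> h x" "\<And>x. h x \<le> 1"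
    "\<And>x. x \<in> K \<Longrightarrow> h x = 1" "\<And>x. x \<notin> U \<Longrightarrow> h x = 0"
proof -
  have "compact_space (euclidean :: 'a topology)" using G by (simp add: compact_space_def)
  moreover have "Hausdorff_space (euclidean :: 'a topology)"
    unfolding Hausdorff_space_def disjnt_def using hausdorff[where 'a='a] by simp
  ultimately have "normal_space (euclidean :: 'a topology)"
    by (intro compact_Hausdorff_or_regular_imp_normal_space) auto
  moreover have "closedin euclidean (- U)" "closedin euclidean K" "disjnt (- U) K"
    using U K by (auto simp: disjnt_def compact_imp_closed)
  ultimately obtain h where "continuous_map euclidean (top_of_set {0..1::real}) h" "h ` (- U) \<subseteq> {0}" "h ` K \<subseteq> {1}"
    by (rule Urysohn_lemma[of _ _ _ 0 1]) auto
  then show thesis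
    by (intro that[of h]) (auto simp: continuous_map_in_subtopology image_subset_iff)
qed

section \<open>Invariance of Haar measure under convolution\<close>

lemma normalized_haarD:
  assumes "normalized_haar m"
  shows "regular_borel_prob m" "distr m borel (\<lambda>x. a + x) = m"
  using assms by (auto simp: normalized_haar_def)

text \<open>The convolution and \<open>m\<close> have the same integral over each continuous
  function. A Urysohn function between \<open>K\<close> and an open neighbourhood carries this over
  to \<open>K\<close>, by outer regularity of \<open>m\<close> alone.\<close>

lemma haar_conv_compact_le:
  fixes m N :: "'a::{topological_ab_group_add, t2_space} measure"
  assumes G: "compact (UNIV :: 'a set)" and m: "normalized_haar m" and N: "regular_borel_prob N"
    and K: "compact K"
  shows "emeasure (measure_conv m N) K \<le> emeasure m K"
proof (rule dense_ge)
  fix a assume a: "emeasure m K < a"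
  note mr = normalized_haarD(1)[OF m]
  note mp = regular_borel_probD(1)[OF mr] and Np = regular_borel_probD(1)[OF N]
  let ?n = "measure_conv m N"
  have np: "?n \<in> borel_probs" by (rule measure_conv_borel_probs[OF mp N])
  have Kb: "K \<in> sets borel" using K by (rule borel_compact)
  obtain U where U: "K \<subseteq> U" "open U" "emeasure m U < a"
    using regular_borel_prob_outer[OF mr Kb a] by metis
  obtain h :: "'a \<Rightarrow> real" where h: "continuous_on UNIV h" "\<And>x. 0 \<le> h x" "\<And>x. h x \<le> 1"
    "\<And>x. x \<in> K \<Longrightarrow> h x = 1" "\<And>x. x \<notin> U \<Longrightarrow> h x = 0"
    using Urysohn_compact[OF G K U(2,1)] by metis
  have "emeasure ?n K = (\<integral>\<^sup>+x. indicator K x \<partial>?n)" using Kb by simp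
  also have "\<dots> \<le> (\<integral>\<^sup>+x. ennreal (h x) \<partial>?n)"
    using h by (intro nn_integral_mono) (auto simp: indicator_def)
  also have "\<dots> = ennreal (\<integral>x. h x \<partial>?n)"
    using h by (intro nn_integral_eq_integral integrable_continuous_compact[OF G np]) auto
  also have "(\<integral>x. h x \<partial>?n) = (\<integral>x. fwd_avg N h x \<partial>m)"
    by (rule integral_measure_conv[OF G mp N h(1)])
  also have "\<dots> = (\<integral>x. h x \<partial>m)"
    by (rule integral_fwd_avg[OF G mp normalized_haarD(2)[OF m] Np h(1)])
  also have "ennreal \<dots> = (\<integral>\<^sup>+x. ennreal (h x) \<partial>m)"
    using h by (intro nn_integral_eq_integral[symmetric] integrable_continuous_compact[OF G mp]) auto
  also have "\<dots> \<le> (\<integral>\<^sup>+x. indicator U x \<partial>m)"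
    using h by (intro nn_integral_mono) (auto simp: indicator_def)
  also have "\<dots> = emeasure m U" using U(2) by (simp add: regular_borel_probD(3)[OF mr])
  finally show "emeasure ?n K \<le> a" using U(3) by simp
qed

text \<open>For a single x, inner regularity gives a compact L with x + L inside \<open>U\<close>. A
  Urysohn function cut at level 1/2 fattens x + L to a compact subset of \<open>U\<close> that still
  contains z + L for all z near x, and finitely many such neighbourhoods cover
  \<open>K\<close>.\<close>

lemma translates_compact_approx:
  fixes N :: "'a::{topological_ab_group_add, t2_space} measure"
  assumes G: "compact (UNIV :: 'a set)" and N: "regular_borel_prob N"
    and U: "open U" and K: "compact K" "\<And>x. x \<in> K \<Longrightarrow> r < emeasure (translates N x) U"
  shows "\<exists>E. compact E \<and> E \<subseteq> U \<and> (\<forall>x\<in>K. r < emeasure (translates N x) E)"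
proof -
  have sN: "sets N = sets borel" by (rule regular_borel_probD(3)[OF N])
  have em: "emeasure (translates N x) A = emeasure N {y. x + y \<in> A}" if "A \<in> sets borel" for A x
  proof -
    have "(\<lambda>y. x + y) \<in> N \<rightarrow>\<^sub>M borel"
      using measurable_add_const by (simp add: sN cong: measurable_cong_sets)
    from emeasure_distr[OF this that] show ?thesis
      by (simp add: translates_def regular_borel_probD(4)[OF N] vimage_def)
  qed
  have "\<exists>V E. open V \<and> x \<in> V \<and> compact E \<and> E \<subseteq> U \<and> (\<forall>z\<in>V. r < emeasure (translates N z) E)"
    if x: "x \<in> K" for x
  proof -
    have "open {y. x + y \<in> U}"
      using open_vimage[OF U, of "\<lambda>y. x + y"] by (simp add: vimage_def continuous_intros)
    then have b: "{y. x + y \<in> U} \<in> sets borel" by simp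
    have "r < emeasure N {y. x + y \<in> U}" using K(2)[OF x] U by (simp add: em)
    then obtain L where L: "L \<subseteq> {y. x + y \<in> U}" "compact L" "r < emeasure N L"
      using regular_borel_prob_inner[OF N b] by metis
    have "compact ((\<lambda>y. x + y) ` L)"
      by (rule compact_continuous_image[OF _ L(2)]) (intro continuous_intros)
    moreover have "(\<lambda>y. x + y) ` L \<subseteq> U" using L(1) by auto
    ultimately obtain h :: "'a \<Rightarrow> real" where h: "continuous_on UNIV h"
      "\<And>z. z \<in> (\<lambda>y. x + y) ` L \<Longrightarrow> h z = 1" "\<And>z. z \<notin> U \<Longrightarrow> h z = 0"
      using Urysohn_compact[OF G _ U] by metis
    define E where "E = {z. 1 / 2 \<le> h z}"
    have "closed E" unfolding E_def by (intro closed_Collect_le continuous_on_const h(1))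
    then have cE: "compact E" using compact_Int_closed[OF G, of E] by simp
    have EU: "E \<subseteq> U" using h(3) by (force simp: E_def)
    define W where "W = {z :: 'a \<times> 'a. 1 / 2 < h (fst z + snd z)}"
    have "continuous_on UNIV (\<lambda>z :: 'a \<times> 'a. h (fst z + snd z))"
      by (rule continuous_on_compose2[OF h(1)]) (auto intro!: continuous_intros)
    then have "open W" unfolding W_def by (intro open_Collect_less continuous_on_const)
    moreover have "{x} \<times> L \<subseteq> W" using h(2) by (auto simp: W_def)
    ultimately obtain V where V: "x \<in> V" "open V" "V \<times> L \<subseteq> W"
      using Elementary_Topology.tube_lemma[OF L(2)] by metis
    have "r < emeasure (translates N z) E" if "z \<in> V" for z
    proof -
      have Eb: "E \<in> sets borel" using cE by (rule borel_compact)
      have "(\<lambda>y. z + y) -` E \<inter> space borel \<in> sets borel"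
        by (rule measurable_sets[OF measurable_add_const Eb])
      then have "{y. z + y \<in> E} \<in> sets N" by (simp add: sN vimage_def)
      moreover have "L \<subseteq> {y. z + y \<in> E}" using V(3) that by (auto simp: W_def E_def)
      ultimately have "emeasure N L \<le> emeasure N {y. z + y \<in> E}" by (intro emeasure_mono)
      then show ?thesis using L(3) by (simp add: em[OF Eb])
    qed
    then show ?thesis using V(1,2) cE EU by blast
  qed
  then have "\<forall>x\<in>K. \<exists>VE. open (fst VE) \<and> x \<in> fst VE \<and> compact (snd VE) \<and> snd VE \<subseteq> U
      \<and> (\<forall>z\<in>fst VE. r < emeasure (translates N z) (snd VE))"
    by fastforce
  from bchoice[OF this] obtain VE where VE: "\<And>x. x \<in> K \<Longrightarrow> open (fst (VE x))" "\<And>x. x \<in> K \<Longrightarrow> x \<in> fst (VE x)"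
    "\<And>x. x \<in> K \<Longrightarrow> compact (snd (VE x))" "\<And>x. x \<in> K \<Longrightarrow> snd (VE x) \<subseteq> U"
    "\<And>x z. x \<in> K \<Longrightarrow> z \<in> fst (VE x) \<Longrightarrow> r < emeasure (translates N z) (snd (VE x))"
    by auto
  obtain C where C: "C \<subseteq> K" "finite C" "K \<subseteq> (\<Union>x\<in>C. fst (VE x))"
    by (rule compactE_image[OF K(1), of K "\<lambda>x. fst (VE x)"]) (use VE(1,2) in auto)
  let ?E = "\<Union>x\<in>C. snd (VE x)"
  have cE: "compact ?E" using C VE(3) by (intro compact_UN) auto
  have "r < emeasure (translates N z) ?E" if z: "z \<in> K" for z
  proof -
    obtain x where x: "x \<in> C" "z \<in> fst (VE x)" using C(3) z by blast
    have "emeasure (translates N z) (snd (VE x)) \<le> emeasure (translates N z) ?E"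
      using x(1) borel_compact[OF cE] by (intro emeasure_mono) (auto simp: translates_def)
    with VE(5)[of x z] x C(1) show ?thesis by (auto intro: less_le_trans)
  qed
  moreover have "?E \<subseteq> U" using C(1) VE(4) by blast
  ultimately show ?thesis using cE by blast
qed

text \<open>Inner regularity of \<open>m * N\<close> on open sets is what makes this work: a supremum of
  \<open>(m * N) C\<close> over compact \<open>C \<subseteq> U\<close> is attained by a \<open>\<sigma>\<close>-compact set \<open>D\<close>, and
  \<open>D\<close> has full translated measure in \<open>U\<close> for almost every translate.\<close>

lemma haar_conv_open_le:
  fixes m N :: "'a::{topological_ab_group_add, t2_space} measure"
  assumes G: "compact (UNIV :: 'a set)" and m: "normalized_haar m" and N: "regular_borel_prob N"
    and U: "open U"
  shows "emeasure (measure_conv m N) U \<le> emeasure m U"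
proof -
  note mr = normalized_haarD(1)[OF m]
  note mp = regular_borel_probD(1)[OF mr] and sm = regular_borel_probD(3)[OF mr]
  define n where "n = measure_conv m N"
  have np: "n \<in> borel_probs" unfolding n_def by (rule measure_conv_borel_probs[OF mp N])
  interpret n: prob_space n by (rule borel_probsD(1)[OF np])
  have sn: "sets n = sets borel" by (rule borel_probsD(2)[OF np])
  let ?T = "\<lambda>A x. emeasure (translates N x) A"
  have nT: "emeasure n A = (\<integral>\<^sup>+x. ?T A x \<partial>m)" if "A \<in> sets borel" for A
    unfolding n_def by (rule emeasure_measure_conv[OF mp N that])
  have kernel: "translates N \<in> m \<rightarrow>\<^sub>M subprob_algebra borel"
    using translates_kernel[OF N] sm by (simp cong: measurable_cong_sets)
  have Tm: "?T A \<in> borel_measurable m" if "A \<in> sets borel" for A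
    by (rule measurable_compose[OF kernel measurable_emeasure_subprob_algebra[OF that]])
  have sT: "sets (translates N x) = sets borel" for x by (simp add: translates_def)
  have Ub: "U \<in> sets borel" using U by simp
  let ?C = "{C. compact C \<and> C \<subseteq> U}"
  have "?C \<noteq> {}" using compact_empty by blast
  from ennreal_SUP_countable_SUP[OF this, of "emeasure n"] obtain f :: "nat \<Rightarrow> ennreal"
    where f: "range f \<subseteq> emeasure n ` ?C" "(SUP C\<in>?C. emeasure n C) = (SUP i. f i)" by auto
  have "\<forall>i. \<exists>C. C \<in> ?C \<and> f i = emeasure n C" using f(1) by auto
  from choice[OF this] obtain C where C: "\<And>i. compact (C i)" "\<And>i. C i \<subseteq> U" "\<And>i. f i = emeasure n (C i)"
    by auto
  define s where "s = (SUP C\<in>?C. emeasure n C)"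
  define Dn where "Dn i = (\<Union>j\<le>i. C j)" for i
  define D where "D = (\<Union>i. C i)"
  have Dn: "compact (Dn i)" "Dn i \<subseteq> U" for i
    using C by (auto simp: Dn_def intro!: compact_UN)
  have D_Dn: "D = (\<Union>i. Dn i)" by (auto simp: D_def Dn_def)
  have inc: "incseq Dn" unfolding incseq_def Dn_def by (intro allI impI UN_mono) auto
  have Db: "D \<in> sets borel" unfolding D_def using borel_compact[OF C(1)] by auto
  have s_le: "s \<le> emeasure n D"
    unfolding s_def f(2) by (rule SUP_least, unfold C(3), rule emeasure_mono) (use Db in \<open>auto simp: D_def sn\<close>)
  \<comment> \<open>\<open>D\<close> already has mass at least \<open>s\<close>, whereas every
    \<open>Dn i \<union> E\<close> is a compact subset of \<open>U\<close> and has mass at most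
    \<open>s\<close>. So \<open>E\<close> adds nothing to \<open>D\<close>.\<close>
  have null: "emeasure n (E - D) = 0" if E: "compact E" "E \<subseteq> U" for E
  proof -
    have Eb: "E \<in> sets borel" using E(1) by (rule borel_compact)
    have "emeasure n (\<Union>i. Dn i \<union> E) = (SUP i. emeasure n (Dn i \<union> E))"
    proof (rule SUP_emeasure_incseq[symmetric])
      show "range (\<lambda>i. Dn i \<union> E) \<subseteq> sets n" using borel_compact[OF Dn(1)] Eb by (auto simp: sn)
      show "incseq (\<lambda>i. Dn i \<union> E)" using inc unfolding incseq_def by blast
    qed
    also have "\<dots> \<le> s"
      unfolding s_def using Dn E by (intro SUP_least SUP_upper) auto
    also have "(\<Union>i. Dn i \<union> E) = D \<union> (E - D)" by (auto simp: D_Dn)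
    also have "emeasure n (D \<union> (E - D)) = emeasure n D + emeasure n (E - D)"
      using Db Eb by (intro plus_emeasure[symmetric]) (auto simp: sn)
    finally have "emeasure n D + emeasure n (E - D) \<le> s" .
    from order_trans[OF this s_le] have "emeasure n D + emeasure n (E - D) \<le> emeasure n D + 0"
      by (simp only: add_0_right)
    then show ?thesis using n.emeasure_finite[of D] by (simp only: ennreal_add_left_cancel_le) auto
  qed
  \<comment> \<open>Otherwise this set contains a compact \<open>K\<close> of positive measure, and
    one compact \<open>E \<subseteq> U\<close> has translated mass above \<open>r\<close> for all x
    in \<open>K\<close>. There \<open>E - D\<close> has positive translated mass, against
    \<open>null\<close>.\<close>
  have level: "AE x in m. \<not> (?T D x < r \<and> r < ?T U x)" for r
  proof -
    let ?S = "{x. ?T D x < r \<and> r < ?T U x}"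
    have S: "?S \<in> sets borel"
    proof -
      have "{x \<in> space m. ?T D x < r \<and> r < ?T U x} \<in> sets m"
        using Tm[OF Db] Tm[OF Ub]
        by (intro sets.sets_Collect_conj borel_measurable_less) auto
      then show ?thesis by (simp add: sm regular_borel_probD(4)[OF mr])
    qed
    have "emeasure m ?S = 0"
    proof (rule ccontr)
      assume "emeasure m ?S \<noteq> 0"
      then have "0 < emeasure m ?S" by (simp add: zero_less_iff_neq_zero)
      then obtain K where K: "K \<subseteq> ?S" "compact K" "0 < emeasure m K"
        by (rule regular_borel_prob_inner[OF mr S])
      have KU: "\<And>x. x \<in> K \<Longrightarrow> r < ?T U x" using K(1) by auto
      obtain E where E: "compact E" "E \<subseteq> U" "\<And>x. x \<in> K \<Longrightarrow> r < ?T E x"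
        using translates_compact_approx[OF G N U K(2) KU] by auto
      have Eb: "E \<in> sets borel" using E(1) by (rule borel_compact)
      have "(\<integral>\<^sup>+x. ?T (E - D) x \<partial>m) = 0" using null[OF E(1,2)] nT[of "E - D"] Eb Db by simp
      then have "AE x in m. ?T (E - D) x = 0"
        using Tm[of "E - D"] Eb Db by (simp add: nn_integral_0_iff_AE)
      then have "AE x in m. x \<notin> K"
      proof eventually_elim
        case (elim x)
        have "?T E x \<le> ?T (D \<union> (E - D)) x" using Eb Db by (intro emeasure_mono) (auto simp: sT)
        also have "\<dots> \<le> ?T D x + ?T (E - D) x"
          using Eb Db by (intro emeasure_subadditive) (auto simp: sT)
        finally have "?T E x \<le> ?T D x" using elim by simp
        then show ?case using E(3)[of x] K(1) by (auto dest: less_le_trans)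
      qed
      then have "emeasure m K = 0"
        using borel_compact[OF K(2)] by (subst (asm) AE_iff_measurable[where N=K]) (auto simp: sm regular_borel_probD(4)[OF mr])
      with K(3) show False by simp
    qed
    then show ?thesis
      using S by (subst AE_iff_measurable[where N="?S"]) (auto simp: sm regular_borel_probD(4)[OF mr])
  qed
  \<comment> \<open>A strict inequality between the two translated masses leaves room for a
    rational, and only countably many null sets are discarded.\<close>
  have "AE x in m. \<forall>q :: rat. \<not> (?T D x < ennreal (real_of_rat q) \<and> ennreal (real_of_rat q) < ?T U x)"
    by (subst AE_all_countable) (intro allI level)
  then have "AE x in m. ?T U x \<le> ?T D x"
  proof eventually_elim
    case (elim x)
    show ?case
    proof (rule ccontr)
      assume "\<not> ?T U x \<le> ?T D x"
      then have "?T D x < ?T U x" by simp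
      from ennreal_rat_dense[OF this] elim show False by auto
    qed
  qed
  then have "emeasure n U \<le> emeasure n D"
    unfolding nT[OF Ub] nT[OF Db] by (rule nn_integral_mono_AE)
  also have "\<dots> = (SUP i. emeasure n (Dn i))"
    unfolding D_Dn using inc Dn(1)
    by (intro SUP_emeasure_incseq[symmetric]) (auto simp: sn intro: borel_compact)
  also have "\<dots> \<le> (SUP i. emeasure m (Dn i))"
    unfolding n_def by (intro SUP_mono) (use haar_conv_compact_le[OF G m N Dn(1)] in blast)
  also have "\<dots> \<le> emeasure m U"
    using Dn(2) Ub by (intro SUP_least emeasure_mono) (auto simp: sm)
  finally show ?thesis unfolding n_def .
qed

text \<open>Outer regularity of \<open>m\<close> extends the inequality from open to Borel sets. Two
  probability measures, one of which is below the other on every Borel set, are equal by passing to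
  complements.\<close>

lemma measure_conv_haar:
  fixes m N :: "'a::{topological_ab_group_add, t2_space} measure"
  assumes G: "compact (UNIV :: 'a set)" and m: "normalized_haar m" and N: "regular_borel_prob N"
  shows "measure_conv m N = m"
proof -
  note mr = normalized_haarD(1)[OF m]
  note mp = regular_borel_probD(1)[OF mr] and sm = regular_borel_probD(3)[OF mr]
  let ?n = "measure_conv m N"
  have np: "?n \<in> borel_probs" by (rule measure_conv_borel_probs[OF mp N])
  interpret n: prob_space ?n by (rule borel_probsD(1)[OF np])
  interpret m: prob_space m by (rule regular_borel_probD(2)[OF mr])
  have le: "emeasure ?n A \<le> emeasure m A" if A: "A \<in> sets borel" for A
  proof (rule dense_ge)
    fix a assume "emeasure m A < a"
    then obtain U where U: "A \<subseteq> U" "open U" "emeasure m U < a"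
      using regular_borel_prob_outer[OF mr A] by metis
    have "emeasure ?n A \<le> emeasure ?n U" using U by (intro emeasure_mono) auto
    also have "\<dots> \<le> emeasure m U" by (rule haar_conv_open_le[OF G m N U(2)])
    finally show "emeasure ?n A \<le> a" using U(3) by simp
  qed
  show ?thesis
  proof (rule measure_eqI)
    show "sets ?n = sets m" by (simp add: sm)
    fix A assume "A \<in> sets ?n"
    then have A: "A \<in> sets borel" by simp
    have "measure ?n A \<le> measure m A" "measure ?n (UNIV - A) \<le> measure m (UNIV - A)"
      using le[of A] le[of "UNIV - A"] A
      by (auto simp: n.emeasure_eq_measure m.emeasure_eq_measure)
    moreover have "measure ?n (UNIV - A) = 1 - measure ?n A" "measure m (UNIV - A) = 1 - measure m A"
      using n.prob_compl[of A] m.prob_compl[of A] A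
      by (simp_all add: sm borel_probsD(3)[OF np] regular_borel_probD(4)[OF mr])
    ultimately show "emeasure ?n A = emeasure m A"
      by (simp add: n.emeasure_eq_measure m.emeasure_eq_measure)
  qed
qed

lemma nn_integral_nn_avg_haar:
  fixes m N :: "'a::{topological_ab_group_add, t2_space} measure"
  assumes G: "compact (UNIV :: 'a set)" and m: "normalized_haar m" and N: "regular_borel_prob N"
    and h: "h \<in> borel_measurable borel"
  shows "(\<integral>\<^sup>+x. nn_avg N h x \<partial>m) = (\<integral>\<^sup>+x. h x \<partial>m)"
  using nn_integral_measure_conv[OF regular_borel_probD(1)[OF normalized_haarD(1)[OF m]] N h]
  by (simp add: measure_conv_haar[OF G m N])

section \<open>Density of continuous functions\<close>

lemma Lp_norm_dominated_tendsto_0: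
  assumes p: "p > 0" and [measurable]: "\<And>n :: nat. F n \<in> borel_measurable M" "W \<in> borel_measurable M"
    and dom: "\<And>n. AE x in M. F n x \<le> W x" and W: "Lp_norm p M W < \<infinity>"
    and lim: "AE x in M. (\<lambda>n. F n x) \<longlonglongrightarrow> 0"
  shows "(\<lambda>n. Lp_norm p M (F n)) \<longlonglongrightarrow> 0"
proof -
  have "(\<lambda>n. \<integral>\<^sup>+x. enn_powr (F n x) p \<partial>M) \<longlonglongrightarrow> (\<integral>\<^sup>+x. 0 \<partial>M)"
  proof (rule nn_integral_dominated_convergence)
    show "AE x in M. enn_powr (F n x) p \<le> enn_powr (W x) p" for n
      using dom[of n] by eventually_elim (use p in \<open>auto intro: enn_powr_mono\<close>)
    show "(\<integral>\<^sup>+x. enn_powr (W x) p \<partial>M) < \<infinity>"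
      using W unfolding Lp_norm_def enn_powr_less_top_iff .
    show "AE x in M. (\<lambda>n. enn_powr (F n x) p) \<longlonglongrightarrow> 0"
      using lim by eventually_elim (rule enn_powr_tendsto_0[OF p])
  qed measurable
  then show ?thesis
    unfolding Lp_norm_def using p by (intro enn_powr_tendsto_0) auto
qed

lemma Lp_spaceD:
  assumes "f \<in> Lp_space p M"
  shows "f \<in> borel_measurable M" "Lp_norm p M (\<lambda>x. ennreal (norm (f x))) < \<infinity>"
  using assms by (auto simp: Lp_space_def)

text \<open>Outer regularity for \<open>A\<close> and for its complement encloses \<open>A\<close>
  between the compact set \<open>- V\<close> and the open set \<open>U\<close>. A Urysohn function
  for this pair agrees with the indicator off the small set \<open>?B\<close>.\<close>

lemma Lp_approx_indicator:
  fixes m :: "'a::t2_space measure"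
  assumes G: "compact (UNIV :: 'a set)" and m: "regular_borel_prob m" and p: "p > 1"
    and A: "A \<in> sets borel" and e: "e > 0"
  shows "\<exists>\<phi>. continuous_on UNIV \<phi> \<and>
    Lp_norm p m (\<lambda>x. ennreal (norm (indicator A x *\<^sub>R c - \<phi> x :: complex))) \<le> ennreal e"
proof -
  interpret prob_space m by (rule regular_borel_probD(2)[OF m])
  note sm = regular_borel_probD(3)[OF m] and spm = regular_borel_probD(4)[OF m]
  \<comment> \<open>The summand 1 allows division by \<open>b\<close> when
    \<open>c = 0\<close>.\<close>
  define b where "b = norm c + 1"
  have b: "b > 0" by (simp add: b_def add_nonneg_pos)
  \<comment> \<open>Two exceptional sets of measure \<open>d\<close> contribute at most b^p * 2 d =
    e^p to the integral.\<close>
  define d where "d = (e / b) powr p / 2"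
  have d: "d > 0" using e b by (simp add: d_def)
  have outer: "\<exists>U. B \<subseteq> U \<and> open U \<and> emeasure m (U - B) \<le> ennreal d" if B: "B \<in> sets borel" for B
  proof -
    have "emeasure m B < emeasure m B + ennreal d"
      using d by (simp add: emeasure_eq_measure ennreal_less_iff flip: ennreal_plus)
    then obtain U where U: "B \<subseteq> U" "open U" "emeasure m U < emeasure m B + ennreal d"
      using regular_borel_prob_outer[OF m B] by metis
    have "emeasure m (U - B) = emeasure m U - emeasure m B"
      using U B by (intro emeasure_Diff) (auto simp: sm)
    also have "\<dots> \<le> ennreal d" using U(3) by (simp add: ennreal_minus_le_iff less_imp_le)
    finally show ?thesis using U by blast
  qed
  obtain U where U: "A \<subseteq> U" "open U" "emeasure m (U - A) \<le> ennreal d" using outer[OF A] by blast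
  obtain V where V: "- A \<subseteq> V" "open V" "emeasure m (V - (- A)) \<le> ennreal d"
    using outer[of "- A"] A by (auto simp: Compl_eq_Diff_UNIV)
  have K: "compact (- V)" "- V \<subseteq> U" using compact_Int_closed[OF G, of "- V"] U V by auto
  obtain h :: "'a \<Rightarrow> real" where h: "continuous_on UNIV h" "\<And>x. 0 \<le> h x" "\<And>x. h x \<le> 1"
    "\<And>x. x \<in> - V \<Longrightarrow> h x = 1" "\<And>x. x \<notin> U \<Longrightarrow> h x = 0"
    using Urysohn_compact[OF G K(1) U(2) K(2)] by metis
  let ?B = "(U - A) \<union> (V - (- A))"
  have Bb: "?B \<in> sets m" using U(2) V(2) A by (auto simp: sm Compl_eq_Diff_UNIV intro!: sets.Un sets.Diff)
  have "emeasure m ?B \<le> ennreal d + ennreal d"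
    using emeasure_subadditive[of "U - A" m "V - (- A)"] add_mono[OF U(3) V(3)] U(2) V(2) A
    by (auto simp: sm Compl_eq_Diff_UNIV intro: order_trans)
  then have B: "emeasure m ?B \<le> ennreal ((e / b) powr p)"
    using d by (simp add: d_def flip: ennreal_plus)
  have "norm (indicator A x *\<^sub>R c - h x *\<^sub>R c) \<le> b * indicator ?B x" for x
  proof -
    have "norm (indicator A x *\<^sub>R c - h x *\<^sub>R c) = \<bar>indicator A x - h x\<bar> * norm c"
      by (simp flip: scaleR_diff_left)
    also have "\<bar>indicator A x - h x\<bar> \<le> indicator ?B x"
    proof (cases "x \<in> ?B")
      case True
      then show ?thesis using h(2,3)[of x] by (simp add: indicator_def)
    next
      case False
      then show ?thesis using h(4,5)[of x] U(1) V(1) by (auto simp: indicator_def)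
    qed
    then have "\<bar>indicator A x - h x\<bar> * norm c \<le> indicator ?B x * b"
      by (intro mult_mono) (auto simp: b_def)
    finally show ?thesis by (simp add: mult.commute)
  qed
  then have "Lp_norm p m (\<lambda>x. ennreal (norm (indicator A x *\<^sub>R c - h x *\<^sub>R c)))
      \<le> Lp_norm p m (\<lambda>x. ennreal (b * indicator ?B x))"
    using p by (intro Lp_norm_mono ennreal_leI) auto
  also have "\<dots> \<le> ennreal e"
  proof -
    have "(\<integral>\<^sup>+x. enn_powr (ennreal (b * indicator ?B x)) p \<partial>m) = (\<integral>\<^sup>+x. ennreal (b powr p) * indicator ?B x \<partial>m)"
      using b by (intro nn_integral_cong) (auto simp: indicator_def enn_powr_ennreal)
    also have "\<dots> = ennreal (b powr p) * emeasure m ?B" using Bb by (rule nn_integral_cmult_indicator)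
    also have "\<dots> \<le> ennreal (b powr p) * ennreal ((e / b) powr p)" using B by (rule mult_left_mono) simp
    also have "\<dots> = enn_powr (ennreal e) p"
      using b e by (simp add: enn_powr_ennreal flip: ennreal_mult powr_mult)
    finally show ?thesis using p by (simp add: Lp_norm_le_iff)
  qed
  finally have "Lp_norm p m (\<lambda>x. ennreal (norm (indicator A x *\<^sub>R c - h x *\<^sub>R c))) \<le> ennreal e" .
  moreover have "continuous_on UNIV (\<lambda>x. h x *\<^sub>R c)"
    by (intro continuous_on_scaleR h(1) continuous_on_const)
  ultimately show ?thesis by blast
qed

lemma borel_measurable_norm_diff:
  fixes f g :: "'a \<Rightarrow> complex"
  assumes "f \<in> borel_measurable M" "g \<in> borel_measurable M"
  shows "(\<lambda>x. ennreal (norm (f x - g x))) \<in> borel_measurable M"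
  using assms by measurable

lemma Lp_norm_diff_triangle:
  fixes f g h :: "'a \<Rightarrow> complex"
  assumes p: "p > 1" and [measurable]: "f \<in> borel_measurable M" "g \<in> borel_measurable M" "h \<in> borel_measurable M"
  shows "Lp_norm p M (\<lambda>x. ennreal (norm (f x - h x)))
    \<le> Lp_norm p M (\<lambda>x. ennreal (norm (f x - g x))) + Lp_norm p M (\<lambda>x. ennreal (norm (g x - h x)))"
proof -
  have "Lp_norm p M (\<lambda>x. ennreal (norm (f x - h x)))
      \<le> Lp_norm p M (\<lambda>x. ennreal (norm (f x - g x)) + ennreal (norm (g x - h x)))"
  proof (rule Lp_norm_mono)
    show "ennreal (norm (f x - h x)) \<le> ennreal (norm (f x - g x)) + ennreal (norm (g x - h x))" for x
      using norm_triangle_ineq[of "f x - g x" "g x - h x"] by (simp flip: ennreal_plus)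
  qed (use p in simp)
  also have "\<dots> \<le> Lp_norm p M (\<lambda>x. ennreal (norm (f x - g x))) + Lp_norm p M (\<lambda>x. ennreal (norm (g x - h x)))"
    by (rule Lp_norm_triangle[OF p]) measurable
  finally show ?thesis .
qed

lemma Lp_approx_sum:
  fixes m :: "'a::t2_space measure" and F :: "'i \<Rightarrow> 'a \<Rightarrow> complex"
  assumes m: "sets m = sets borel" and p: "p > 1" and "finite I" and "\<And>i. i \<in> I \<Longrightarrow> F i \<in> borel_measurable borel"
    and "\<And>i e. i \<in> I \<Longrightarrow> e > 0 \<Longrightarrow> \<exists>\<phi>. continuous_on UNIV \<phi> \<and>
      Lp_norm p m (\<lambda>x. ennreal (norm (F i x - \<phi> x))) \<le> ennreal e"
    and "e > 0"
  shows "\<exists>\<phi>. continuous_on UNIV \<phi> \<and>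
    Lp_norm p m (\<lambda>x. ennreal (norm ((\<Sum>i\<in>I. F i x) - \<phi> x))) \<le> ennreal e"
  using assms(3-)
proof (induction I arbitrary: e)
  case empty
  then show ?case using p
    by (intro exI[of _ "\<lambda>_. 0"]) (auto simp: Lp_norm_def)
next
  case (insert i I)
  have fi: "F i \<in> borel_measurable borel" "(\<lambda>x. \<Sum>i\<in>I. F i x) \<in> borel_measurable borel"
    using insert.prems(1) by auto
  obtain \<phi> where \<phi>: "continuous_on UNIV \<phi>" "Lp_norm p m (\<lambda>x. ennreal (norm (F i x - \<phi> x))) \<le> ennreal (e / 2)"
    using insert.prems(2)[of i "e / 2"] insert.prems(3) by auto
  obtain \<psi> where \<psi>: "continuous_on UNIV \<psi>"
    "Lp_norm p m (\<lambda>x. ennreal (norm ((\<Sum>i\<in>I. F i x) - \<psi> x))) \<le> ennreal (e / 2)"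
    using insert.IH[of "e / 2"] insert.prems by auto
  note meas = borel_measurable_continuous_onI[OF \<phi>(1)] borel_measurable_continuous_onI[OF \<psi>(1)] fi
  have "Lp_norm p m (\<lambda>x. ennreal (norm ((\<Sum>i\<in>insert i I. F i x) - (\<phi> x + \<psi> x))))
      \<le> Lp_norm p m (\<lambda>x. ennreal (norm (F i x - \<phi> x)) + ennreal (norm ((\<Sum>i\<in>I. F i x) - \<psi> x)))"
  proof (rule Lp_norm_mono)
    fix x
    have "norm ((\<Sum>i\<in>insert i I. F i x) - (\<phi> x + \<psi> x)) \<le> norm (F i x - \<phi> x) + norm ((\<Sum>i\<in>I. F i x) - \<psi> x)"
      using norm_triangle_ineq[of "F i x - \<phi> x" "(\<Sum>i\<in>I. F i x) - \<psi> x"] insert.hyps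
      by (simp add: algebra_simps)
    then show "ennreal (norm ((\<Sum>i\<in>insert i I. F i x) - (\<phi> x + \<psi> x)))
        \<le> ennreal (norm (F i x - \<phi> x)) + ennreal (norm ((\<Sum>i\<in>I. F i x) - \<psi> x))"
      by (simp flip: ennreal_plus)
  qed (use p in simp)
  also have "\<dots> \<le> Lp_norm p m (\<lambda>x. ennreal (norm (F i x - \<phi> x))) + Lp_norm p m (\<lambda>x. ennreal (norm ((\<Sum>i\<in>I. F i x) - \<psi> x)))"
    using meas by (intro Lp_norm_triangle[OF p] borel_measurable_norm_diff) (simp_all add: m cong: measurable_cong_sets)
  also have "\<dots> \<le> ennreal (e / 2) + ennreal (e / 2)" by (intro add_mono \<phi>(2) \<psi>(2))
  also have "\<dots> = ennreal e" using insert.prems(3) by (simp flip: ennreal_plus)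
  finally show ?case using continuous_on_add[OF \<phi>(1) \<psi>(1)] by blast
qed

lemma Lp_dense_continuous:
  fixes m :: "'a::t2_space measure"
  assumes G: "compact (UNIV :: 'a set)" and m: "regular_borel_prob m" and p: "p > 1"
    and f: "f \<in> Lp_space p m" and e: "e > 0"
  shows "\<exists>\<phi>. continuous_on UNIV \<phi> \<and> Lp_norm p m (\<lambda>x. ennreal (norm (f x - \<phi> x))) \<le> ennreal e"
proof -
  note sm = regular_borel_probD(3)[OF m] and spm = regular_borel_probD(4)[OF m]
  have fm: "f \<in> borel_measurable m" by (rule Lp_spaceD(1)[OF f])
  obtain S where S: "\<And>i. simple_function m (S i)" "\<And>x. (\<lambda>i. S i x) \<longlonglongrightarrow> f x"
    "\<And>i x. dist (S i x) 0 \<le> 2 * dist (f x) 0"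
    using borel_measurable_implies_sequence_metric[OF fm, of 0] by (auto simp: spm)
  have Sm: "S i \<in> borel_measurable m" for i by (rule borel_measurable_simple_function[OF S(1)])
  have "(\<lambda>i. Lp_norm p m (\<lambda>x. ennreal (norm (f x - S i x)))) \<longlonglongrightarrow> 0"
  \<comment> \<open>The simple functions satisfy |S i| <= 2 |f|, whence the factor 3 for the
    difference.\<close>
  proof (rule Lp_norm_dominated_tendsto_0[where W="\<lambda>x. ennreal 3 * ennreal (norm (f x))"])
    show "AE x in m. ennreal (norm (f x - S i x)) \<le> ennreal 3 * ennreal (norm (f x))" for i
    proof (rule AE_I2)
      fix x
      have "norm (f x - S i x) \<le> 3 * norm (f x)"
        using norm_triangle_ineq4[of "f x" "S i x"] S(3)[of i x] by simp
      then show "ennreal (norm (f x - S i x)) \<le> ennreal 3 * ennreal (norm (f x))"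
        by (simp flip: ennreal_mult ennreal_numeral)
    qed
    have "(\<integral>\<^sup>+x. enn_powr (ennreal 3 * ennreal (norm (f x))) p \<partial>m)
        = enn_powr (ennreal 3) p * (\<integral>\<^sup>+x. enn_powr (ennreal (norm (f x))) p \<partial>m)"
      using p fm by (simp add: enn_powr_mult nn_integral_cmult)
    also have "\<dots> < \<infinity>"
      using Lp_spaceD(2)[OF f] unfolding Lp_norm_def enn_powr_less_top_iff
      by (simp add: ennreal_mult_less_top enn_powr_ennreal del: ennreal_numeral)
    finally show "Lp_norm p m (\<lambda>x. ennreal 3 * ennreal (norm (f x))) < \<infinity>"
      unfolding Lp_norm_def enn_powr_less_top_iff .
    show "AE x in m. (\<lambda>i. ennreal (norm (f x - S i x))) \<longlonglongrightarrow> 0"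
    proof (rule AE_I2)
      fix x
      have "(\<lambda>i. norm (f x - S i x)) \<longlonglongrightarrow> norm (f x - f x)"
        by (intro tendsto_norm tendsto_diff tendsto_const S(2))
      then show "(\<lambda>i. ennreal (norm (f x - S i x))) \<longlonglongrightarrow> 0"
        using tendsto_ennrealI by fastforce
    qed
  qed (use p fm Sm in \<open>auto intro: borel_measurable_norm_diff\<close>)
  from order_tendstoD(2)[OF this, of "ennreal (e / 2)"] e
  obtain i where i: "Lp_norm p m (\<lambda>x. ennreal (norm (f x - S i x))) < ennreal (e / 2)"
    by (auto simp: eventually_sequentially)
  have rep: "S i x = (\<Sum>y\<in>S i ` space m. indicator (S i -` {y} \<inter> space m) x *\<^sub>R y)" for x
    by (rule simple_function_indicator_representation_banach[OF S(1)]) (simp add: spm)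
  have "\<exists>\<phi>. continuous_on UNIV \<phi> \<and> Lp_norm p m (\<lambda>x. ennreal (norm
      ((\<Sum>y\<in>S i ` space m. indicator (S i -` {y} \<inter> space m) x *\<^sub>R y) - \<phi> x))) \<le> ennreal (e / 2)"
  proof (rule Lp_approx_sum[OF sm p])
    show "finite (S i ` space m)" by (rule simple_functionD(1)[OF S(1)])
    have b: "S i -` {y} \<inter> space m \<in> sets borel" for y
      using simple_functionD(2)[OF S(1)] by (simp add: sm)
    show "(\<lambda>x. indicator (S i -` {y} \<inter> space m) x *\<^sub>R y) \<in> borel_measurable borel" for y
      using b[of y] by measurable
    show "\<exists>\<phi>. continuous_on UNIV \<phi> \<and> Lp_norm p m
        (\<lambda>x. ennreal (norm (indicator (S i -` {y} \<inter> space m) x *\<^sub>R y - \<phi> x))) \<le> ennreal d" if "d > 0" for y d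
      by (rule Lp_approx_indicator[OF G m p b that])
  qed (use e in simp)
  then obtain \<phi> where \<phi>: "continuous_on UNIV \<phi>" "Lp_norm p m (\<lambda>x. ennreal (norm (S i x - \<phi> x))) \<le> ennreal (e / 2)"
    unfolding rep[symmetric] by blast
  have "Lp_norm p m (\<lambda>x. ennreal (norm (f x - \<phi> x)))
      \<le> Lp_norm p m (\<lambda>x. ennreal (norm (f x - S i x))) + Lp_norm p m (\<lambda>x. ennreal (norm (S i x - \<phi> x)))"
    using borel_measurable_continuous_onI[OF \<phi>(1)]
    by (intro Lp_norm_diff_triangle p fm Sm) (simp add: sm cong: measurable_cong_sets)
  also have "\<dots> \<le> ennreal (e / 2) + ennreal (e / 2)" using i \<phi>(2) by (intro add_mono) auto
  also have "\<dots> = ennreal e" using e by (simp flip: ennreal_plus)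
  finally show ?thesis using \<phi>(1) by blast
qed

section \<open>Maximal inequality and convergence\<close>

text \<open>Splitting a step of law M * K into a step of law \<open>M\<close> followed by one of law
  \<open>K\<close> only adds an intermediate time to the walk. For the backward average the two
  factors come out in the opposite order, so Fubini is needed there.\<close>

lemma chain_maps_merge:
  fixes f :: "'a::topological_ab_group_add \<Rightarrow> real"
  assumes G: "compact (UNIV :: 'a set)" and M: "regular_borel_prob M" and K: "regular_borel_prob K"
    and ks: "set ks \<subseteq> borel_probs" and f: "continuous_on UNIV f"
  shows "chain_maps (measure_conv M K # ks) f \<subseteq> chain_maps (M # K # ks) f"
proof -
  note Mp = regular_borel_probD(1)[OF M] and Kp = regular_borel_probD(1)[OF K]
  have tr: "fwd_avg K (\<lambda>y. u (c + y)) a = fwd_avg K u (c + a)" for u :: "'a \<Rightarrow> real" and c a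
    by (simp add: fwd_avg_def add.assoc)
  have fwd: "fwd_avg (measure_conv M K) u = fwd_avg M (fwd_avg K u)" if u: "continuous_on UNIV u" for u :: "'a \<Rightarrow> real"
  proof
    fix x
    have c: "continuous_on UNIV (\<lambda>y. u (x + y))"
      by (rule continuous_on_compose2[OF u]) (auto intro!: continuous_intros)
    show "fwd_avg (measure_conv M K) u x = fwd_avg M (fwd_avg K u) x"
      using integral_measure_conv[OF G Mp K c] by (simp add: tr fwd_avg_def[of "measure_conv M K"] fwd_avg_def[of M])
  qed
  have bwd: "bwd_avg (measure_conv M K) f = bwd_avg K (bwd_avg M f)"
  proof
    fix x
    have c: "continuous_on UNIV (\<lambda>y. f (x - y))"
      by (rule continuous_on_compose2[OF f]) (auto intro!: continuous_intros)
    have c2: "continuous_on UNIV (\<lambda>(a, b). f (x - (a + b)))"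
      unfolding case_prod_unfold by (rule continuous_on_compose2[OF f]) (auto intro!: continuous_intros)
    have "bwd_avg (measure_conv M K) f x = (\<integral>a. \<integral>b. f (x - (a + b)) \<partial>K \<partial>M)"
      using integral_measure_conv[OF G Mp K c] by (simp add: bwd_avg_def fwd_avg_def)
    also have "\<dots> = (\<integral>b. \<integral>a. f (x - (a + b)) \<partial>M \<partial>K)"
      by (rule integral_swap_continuous[OF G G Mp Kp c2])
    also have "\<dots> = bwd_avg K (bwd_avg M f) x" by (simp add: bwd_avg_def algebra_simps)
    finally show "bwd_avg (measure_conv M K) f x = bwd_avg K (bwd_avg M f) x" .
  qed
  have "continuous_on UNIV (bwd_avg K (bwd_avg M f))"
    by (intro continuous_bwd_avg[OF G] Mp Kp f)
  then show ?thesis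
    using fwd chain_maps_continuous[OF G ks] by (auto simp: bwd)
qed

text \<open>The list is \<open>lam n\<close>, kap_(n-1), ..., kap_1. Its partial convolutions are
  \<open>lam n\<close>, ..., \<open>lam 1\<close>, so the walk passes through all these laws; the
  list is the same for every \<open>f\<close>.\<close>

lemma averages_in_chain_maps:
  fixes lam :: "nat \<Rightarrow> 'a::topological_ab_group_add measure"
  assumes G: "compact (UNIV :: 'a set)"
    and lam: "\<And>s. s \<ge> 1 \<Longrightarrow> regular_borel_prob (lam s)"
    and fac: "\<And>s. s \<ge> 1 \<Longrightarrow> \<exists>kap. regular_borel_prob kap \<and> lam s = measure_conv (lam (s + 1)) kap"
    and n: "n \<ge> 1"
  shows "\<exists>ks. set ks \<subseteq> borel_probs \<and> (\<forall>f s. continuous_on UNIV f \<longrightarrow> s \<in> {1..n} \<longrightarrow>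
    fwd_avg (lam s) (bwd_avg (lam s) f) \<in> chain_maps ks f)"
proof -
  have self: "f \<in> chain_maps ks f" for ks and f :: "'a \<Rightarrow> real" by (cases ks) auto
  \<comment> \<open>Keeping \<open>lam n\<close> visible at the head lets the next step of the
    induction split it by its factorization.\<close>
  have "\<exists>ks. set ks \<subseteq> borel_probs \<and> (\<forall>f s. continuous_on UNIV f \<longrightarrow> s \<in> {1..n} \<longrightarrow>
      fwd_avg (lam s) (bwd_avg (lam s) f) \<in> chain_maps (lam n # ks) f)"
    using n
  proof (induction n rule: nat_induct_at_least)
    case base
    show ?case by (intro exI[of _ "[]"]) auto
  next
    case (Suc n)
    then obtain ks where ks: "set ks \<subseteq> borel_probs"
      "\<And>f s. continuous_on UNIV f \<Longrightarrow> s \<in> {1..n} \<Longrightarrow>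
        fwd_avg (lam s) (bwd_avg (lam s) f) \<in> chain_maps (lam n # ks) f"
      by blast
    obtain kap where kap: "regular_borel_prob kap" "lam n = measure_conv (lam (n + 1)) kap"
      using fac[OF Suc.hyps] by blast
    have "fwd_avg (lam s) (bwd_avg (lam s) f) \<in> chain_maps (lam (Suc n) # kap # ks) f"
      if f: "continuous_on UNIV f" and s: "s \<in> {1..Suc n}" for f s
    proof (cases "s = Suc n")
      case True
      then show ?thesis using self[of "bwd_avg (lam s) f" "kap # ks"] by auto
    next
      case False
      then have "fwd_avg (lam s) (bwd_avg (lam s) f) \<in> chain_maps (lam n # ks) f"
        using s by (intro ks(2) f) auto
      then show ?thesis
        using chain_maps_merge[OF G lam kap(1) ks(1) f, of "n + 1"] kap(2) by auto
    qed
    then show ?case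
      using ks(1) regular_borel_probD(1)[OF kap(1)] by (intro exI[of _ "kap # ks"]) auto
  qed
  then obtain ks where "set ks \<subseteq> borel_probs" "\<forall>f s. continuous_on UNIV f \<longrightarrow> s \<in> {1..n} \<longrightarrow>
      fwd_avg (lam s) (bwd_avg (lam s) f) \<in> chain_maps (lam n # ks) f" by blast
  then show ?thesis
    using regular_borel_probD(1)[OF lam[OF n]] by (intro exI[of _ "lam n # ks"]) auto
qed

lemma maximal_inequality_continuous:
  fixes f :: "'a::{topological_ab_group_add, t2_space} \<Rightarrow> real"
  assumes G: "compact (UNIV :: 'a set)" and haar: "normalized_haar m"
    and lam: "\<And>s. s \<ge> 1 \<Longrightarrow> regular_borel_prob (lam s)"
    and fac: "\<And>s. s \<ge> 1 \<Longrightarrow> \<exists>kap. regular_borel_prob kap \<and> lam s = measure_conv (lam (s + 1)) kap"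
    and n: "n \<ge> (1 :: nat)" and p: "p > 1" and f: "continuous_on UNIV f" "\<And>x. f x \<ge> 0"
  shows "Lp_norm p m (\<lambda>x. SUP s\<in>{1..n}. ennreal (fwd_avg (lam s) (bwd_avg (lam s) f) x))
    \<le> ennreal (p / (p - 1)) * Lp_norm p m (\<lambda>x. ennreal (f x))"
proof -
  note mp = regular_borel_probD(1)[OF normalized_haarD(1)[OF haar]]
  obtain ks where ks: "set ks \<subseteq> borel_probs"
    "\<And>s. s \<in> {1..n} \<Longrightarrow> fwd_avg (lam s) (bwd_avg (lam s) f) \<in> chain_maps ks f"
    using averages_in_chain_maps[where lam=lam, OF G lam fac n] f(1) by meson
  \<comment> \<open>A common majorant for the p-th powers of all the averages, hence of their
    maximum.\<close>
  let ?L = "chain_exp ks f (\<lambda>y. \<bar>y\<bar> powr p) 0"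
  define q where "q = p / (p - 1)"
  have q: "q > 0" using p by (simp add: q_def)
  have t0: "fwd_avg (lam s) (bwd_avg (lam s) f) x \<ge> 0" for s x
    using f(2) by (auto simp: fwd_avg_def bwd_avg_def intro!: Bochner_Integration.integral_nonneg)
  have t: "fwd_avg (lam s) (bwd_avg (lam s) f) x powr p \<le> ?L x" if "s \<in> {1..n}" for s x
    by (rule chain_maps_powr_le[OF G p ks(1) f(1) ks(2)[OF that] t0])
  have L0: "?L x \<ge> 0" for x using t[of 1 x] n by (force intro: order_trans[rotated])
  have cL: "continuous_on UNIV ?L"
    by (intro continuous_chain_exp_section[OF G ks(1) f(1)] continuous_abs_powr) (use p in auto)
  have fp: "continuous_on UNIV (\<lambda>x. f x powr p)"
    by (rule continuous_on_powr'[OF f(1) continuous_on_const]) (use p f in auto)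
  have "(\<integral>\<^sup>+x. enn_powr (SUP s\<in>{1..n}. ennreal (fwd_avg (lam s) (bwd_avg (lam s) f) x)) p \<partial>m)
      \<le> (\<integral>\<^sup>+x. ennreal (?L x) \<partial>m)"
  proof (rule nn_integral_mono)
    fix x
    show "enn_powr (SUP s\<in>{1..n}. ennreal (fwd_avg (lam s) (bwd_avg (lam s) f) x)) p \<le> ennreal (?L x)"
      using p t t0 by (subst enn_powr_SUP) (auto intro!: SUP_least ennreal_leI simp: enn_powr_ennreal)
  qed
  also have "\<dots> = ennreal (\<integral>x. ?L x \<partial>m)"
    using L0 by (intro nn_integral_eq_integral integrable_continuous_compact[OF G mp cL]) auto
  also have "\<dots> \<le> ennreal (q powr p * (\<integral>x. f x powr p \<partial>m))"
    unfolding q_def by (intro ennreal_leI Doob_chain_exp[OF G p mp normalized_haarD(2)[OF haar] ks(1) f])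
  also have "\<dots> = ennreal (q powr p) * ennreal (\<integral>x. f x powr p \<partial>m)"
    by (intro ennreal_mult) auto
  also have "ennreal (\<integral>x. f x powr p \<partial>m) = (\<integral>\<^sup>+x. ennreal (f x powr p) \<partial>m)"
    by (intro nn_integral_eq_integral[symmetric] integrable_continuous_compact[OF G mp fp]) auto
  also have "\<dots> = enn_powr (Lp_norm p m (\<lambda>x. ennreal (f x))) p"
    using p f(2) by (simp add: enn_powr_Lp_norm enn_powr_ennreal)
  also have "ennreal (q powr p) = enn_powr (ennreal q) p" using q by (simp add: enn_powr_ennreal)
  finally show ?thesis
    using p by (simp add: Lp_norm_le_iff enn_powr_mult q_def)
qed

section \<open>Averages of Borel functions and the extension to L^p\<close>

text \<open>The two averages stand in the order in which \<open>measure_conv\<close> integrates, so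
  a Borel \<open>h\<close> is treated without exchanging integrals.\<close>

lemma nn_integral_minus_self_conv:
  fixes N :: "'a::topological_ab_group_add measure"
  assumes N: "regular_borel_prob N" and h: "h \<in> borel_measurable borel"
  shows "(\<integral>\<^sup>+y. h (x - y) \<partial>measure_conv N (reflected N)) = nn_avg (reflected N) (nn_avg N h) x"
proof -
  note Np = regular_borel_probD(1)[OF N]
  have g: "(\<lambda>y. h (z - y)) \<in> borel_measurable borel" for z
    by (rule measurable_compose[OF measurable_diff_const h])
  have g': "(\<lambda>y. h (x - (a + y))) \<in> borel_measurable borel" for a
    using g[of "x - a"] by (simp add: algebra_simps)
  have g'': "(\<lambda>y. nn_avg N h (x + y)) \<in> borel_measurable borel"
    by (rule measurable_compose[OF measurable_add_const borel_measurable_nn_avg[OF N h]])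
  have "(\<integral>\<^sup>+y. h (x - y) \<partial>measure_conv N (reflected N)) = (\<integral>\<^sup>+a. \<integral>\<^sup>+b. h (x - (a + b)) \<partial>reflected N \<partial>N)"
    using nn_integral_measure_conv[OF Np regular_borel_prob_reflected[OF N] g[of x]] by (simp add: nn_avg_def)
  also have "\<dots> = (\<integral>\<^sup>+a. nn_avg N h (x - a) \<partial>N)"
    by (simp add: nn_integral_reflected[OF Np g'] nn_avg_def algebra_simps)
  also have "\<dots> = nn_avg (reflected N) (nn_avg N h) x"
    unfolding nn_avg_def[of "reflected N"] nn_integral_reflected[OF Np g''] by simp
  finally show ?thesis .
qed

text \<open>For continuous \<open>f\<close> the exchange is allowed and gives the order that the
  chain produces: backward average first, then forward.\<close>

lemma integral_minus_self_conv:
  fixes f :: "'a::topological_ab_group_add \<Rightarrow> real"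
  assumes G: "compact (UNIV :: 'a set)" and N: "regular_borel_prob N" and f: "continuous_on UNIV f"
  shows "(\<integral>y. f (x - y) \<partial>measure_conv N (reflected N)) = fwd_avg N (bwd_avg N f) x"
proof -
  note Np = regular_borel_probD(1)[OF N]
  have c: "continuous_on UNIV (\<lambda>y. f (x - y))"
    by (rule continuous_on_compose2[OF f]) (auto intro!: continuous_intros)
  have c2: "continuous_on UNIV (\<lambda>(a, b). f (x - (a - b)))"
    unfolding case_prod_unfold by (rule continuous_on_compose2[OF f]) (auto intro!: continuous_intros)
  have "(\<integral>y. f (x - y) \<partial>measure_conv N (reflected N)) = (\<integral>a. \<integral>b. f (x - (a - b)) \<partial>N \<partial>N)"
    using integral_measure_conv[OF G Np regular_borel_prob_reflected[OF N] c]
    by (simp add: fwd_avg_reflected[OF Np c] bwd_avg_def)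
  also have "\<dots> = (\<integral>b. \<integral>a. f (x - (a - b)) \<partial>N \<partial>N)"
    by (rule integral_swap_continuous[OF G G Np Np c2])
  also have "\<dots> = fwd_avg N (bwd_avg N f) x" by (simp add: fwd_avg_def bwd_avg_def algebra_simps)
  finally show ?thesis .
qed

lemma nn_integral_minus_self_conv_measurable:
  fixes N :: "'a::topological_ab_group_add measure"
  assumes N: "regular_borel_prob N" and h: "h \<in> borel_measurable borel"
  shows "(\<lambda>x. \<integral>\<^sup>+y. h (x - y) \<partial>measure_conv N (reflected N)) \<in> borel_measurable borel"
  using borel_measurable_nn_avg[OF regular_borel_prob_reflected[OF N] borel_measurable_nn_avg[OF N h]]
  by (simp add: nn_integral_minus_self_conv[OF N h])

text \<open>Jensen's inequality for the probability measure N * reflected N, followed by invariance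
  of \<open>m\<close> under convolution with each of the two factors.\<close>

lemma Lp_norm_self_conv_le:
  fixes N :: "'a::{topological_ab_group_add, t2_space} measure"
  assumes G: "compact (UNIV :: 'a set)" and haar: "normalized_haar m"
    and N: "regular_borel_prob N" and p: "p > 1" and h: "h \<in> borel_measurable borel"
  shows "Lp_norm p m (\<lambda>x. \<integral>\<^sup>+y. h (x - y) \<partial>measure_conv N (reflected N)) \<le> Lp_norm p m h"
proof -
  let ?n = "measure_conv N (reflected N)"
  note Np = regular_borel_probD(1)[OF N] and rN = regular_borel_prob_reflected[OF N]
  have np: "?n \<in> borel_probs" by (rule measure_conv_borel_probs[OF Np rN])
  have hp: "(\<lambda>x. enn_powr (h x) p) \<in> borel_measurable borel"
    by (rule measurable_compose[OF h measurable_enn_powr])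
  have "(\<integral>\<^sup>+x. enn_powr (\<integral>\<^sup>+y. h (x - y) \<partial>?n) p \<partial>m) \<le> (\<integral>\<^sup>+x. \<integral>\<^sup>+y. enn_powr (h (x - y)) p \<partial>?n \<partial>m)"
  proof (intro nn_integral_mono nn_integral_enn_powr_Jensen p borel_probsD(1)[OF np])
    show "(\<lambda>y. h (x - y)) \<in> borel_measurable ?n" for x
      using measurable_compose[OF measurable_diff_const h] by (simp cong: measurable_cong_sets)
  qed
  also have "\<dots> = (\<integral>\<^sup>+x. nn_avg (reflected N) (nn_avg N (\<lambda>x. enn_powr (h x) p)) x \<partial>m)"
    by (simp add: nn_integral_minus_self_conv[OF N hp])
  also have "\<dots> = (\<integral>\<^sup>+x. enn_powr (h x) p \<partial>m)"
    by (simp add: nn_integral_nn_avg_haar[OF G haar rN borel_measurable_nn_avg[OF N hp]]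
        nn_integral_nn_avg_haar[OF G haar N hp])
  finally show ?thesis using p by (simp add: Lp_norm_le_iff enn_powr_Lp_norm)
qed

text \<open>The approximation error is not yet under control for the maximum, so it is bounded by
  the sum of its averages, each of norm at most \<open>d\<close> by contractivity. This is
  affordable only for finitely many indices.\<close>

lemma maximal_inequality_finite:
  fixes f :: "'a::{topological_ab_group_add, t2_space} \<Rightarrow> complex"
  assumes G: "compact (UNIV :: 'a set)" and haar: "normalized_haar m"
    and lam: "\<And>s. s \<ge> 1 \<Longrightarrow> regular_borel_prob (lam s)"
    and fac: "\<And>s. s \<ge> 1 \<Longrightarrow> \<exists>kap. regular_borel_prob kap \<and> lam s = measure_conv (lam (s + 1)) kap"
    and mu: "\<And>s. s \<ge> 1 \<Longrightarrow> mu s = measure_conv (lam s) (reflected (lam s))"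
    and n: "n \<ge> (1 :: nat)" and p: "p > 1" and f: "f \<in> Lp_space p m"
  shows "Lp_norm p m (\<lambda>x. SUP s\<in>{1..n}. \<integral>\<^sup>+y. ennreal (norm (f (x - y))) \<partial>mu s)
    \<le> ennreal (p / (p - 1)) * Lp_norm p m (\<lambda>x. ennreal (norm (f x)))"
proof (rule ennreal_le_epsilon)
  fix e :: real assume e: "e > 0"
  note mr = normalized_haarD(1)[OF haar]
  note sm = regular_borel_probD(3)[OF mr]
  define q where "q = p / (p - 1)"
  have q: "q > 0" using p by (simp add: q_def)
  \<comment> \<open>The \<open>n\<close> averages of the error cost n d, and comparing the norms of
    the approximation and of \<open>f\<close> costs q d; together this is \<open>e\<close>.\<close>
  define d where "d = e / (q + real n)"
  have d: "d > 0" using e q by (simp add: d_def add_pos_nonneg)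
  obtain \<phi> where \<phi>: "continuous_on UNIV \<phi>" "Lp_norm p m (\<lambda>x. ennreal (norm (f x - \<phi> x))) \<le> ennreal d"
    using Lp_dense_continuous[OF G mr p f d] by blast
  have fb: "f \<in> borel_measurable borel"
    using Lp_spaceD(1)[OF f] by (simp add: sm cong: measurable_cong_sets)
  have \<phi>b: "\<phi> \<in> borel_measurable borel" by (rule borel_measurable_continuous_onI[OF \<phi>(1)])
  let ?h = "\<lambda>x. ennreal (norm (f x))" and ?d = "\<lambda>x. ennreal (norm (f x - \<phi> x))"
  let ?g = "\<lambda>x. norm (\<phi> x)"
  have meas: "?d \<in> borel_measurable borel" "(\<lambda>x. ennreal (?g x)) \<in> borel_measurable borel" "?h \<in> borel_measurable borel"
    using fb \<phi>b by measurable
  have gc: "continuous_on UNIV ?g" by (rule continuous_on_norm[OF \<phi>(1)])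
  let ?S = "\<lambda>x. SUP s\<in>{1..n}. ennreal (fwd_avg (lam s) (bwd_avg (lam s) ?g) x)"
  let ?D = "\<lambda>s x. \<integral>\<^sup>+y. ?d (x - y) \<partial>mu s"
  have Dm: "?D s \<in> borel_measurable borel" if "s \<in> {1..n}" for s
    using nn_integral_minus_self_conv_measurable[OF lam meas(1), of s] mu[of s] that by simp
  have bnd: "(\<integral>\<^sup>+y. ?h (x - y) \<partial>mu s) \<le> ennreal (fwd_avg (lam s) (bwd_avg (lam s) ?g) x) + ?D s x"
    if s: "s \<in> {1..n}" for s x
  proof -
    have s1: "s \<ge> 1" using s by simp
    note ls = lam[OF s1]
    have mp: "mu s \<in> borel_probs"
      unfolding mu[OF s1] by (rule measure_conv_borel_probs[OF regular_borel_probD(1)[OF ls] regular_borel_prob_reflected[OF ls]])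
    have m1: "(\<lambda>y. k (x - y)) \<in> borel_measurable (mu s)" if "k \<in> borel_measurable borel" for k :: "'a \<Rightarrow> ennreal"
      using measurable_compose[OF measurable_diff_const that] by (simp add: borel_probsD(2)[OF mp] cong: measurable_cong_sets)
    have c: "continuous_on UNIV (\<lambda>y. ?g (x - y))"
      by (rule continuous_on_compose2[OF gc]) (auto intro!: continuous_intros)
    have "(\<integral>\<^sup>+y. ?h (x - y) \<partial>mu s) \<le> (\<integral>\<^sup>+y. ennreal (?g (x - y)) + ?d (x - y) \<partial>mu s)"
    proof (rule nn_integral_mono)
      fix y
      show "?h (x - y) \<le> ennreal (?g (x - y)) + ?d (x - y)"
        using norm_triangle_ineq[of "\<phi> (x - y)" "f (x - y) - \<phi> (x - y)"] by (simp flip: ennreal_plus)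
    qed
    also have "\<dots> = (\<integral>\<^sup>+y. ennreal (?g (x - y)) \<partial>mu s) + ?D s x"
      by (rule nn_integral_add[OF m1[OF meas(2)] m1[OF meas(1)]])
    also have "(\<integral>\<^sup>+y. ennreal (?g (x - y)) \<partial>mu s) = ennreal (\<integral>y. ?g (x - y) \<partial>mu s)"
      by (intro nn_integral_eq_integral integrable_continuous_compact[OF G mp c]) auto
    also have "(\<integral>y. ?g (x - y) \<partial>mu s) = fwd_avg (lam s) (bwd_avg (lam s) ?g) x"
      unfolding mu[OF s1] by (rule integral_minus_self_conv[OF G ls gc])
    finally show ?thesis .
  qed
  have Sm: "?S \<in> borel_measurable m"
  proof (rule borel_measurable_SUP)
    fix s assume "s \<in> {1..n}"
    then have l: "lam s \<in> borel_probs" using regular_borel_probD(1)[OF lam[of s]] by simp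
    have "fwd_avg (lam s) (bwd_avg (lam s) ?g) \<in> borel_measurable borel"
      by (intro borel_measurable_continuous_onI continuous_fwd_avg[OF G l] continuous_bwd_avg[OF G l gc])
    then show "(\<lambda>x. ennreal (fwd_avg (lam s) (bwd_avg (lam s) ?g) x)) \<in> borel_measurable m"
      by (simp add: sm cong: measurable_cong_sets)
  qed simp
  have Dm': "?D s \<in> borel_measurable m" if "s \<in> {1..n}" for s
    using Dm[OF that] by (simp add: sm cong: measurable_cong_sets)
  have "Lp_norm p m (\<lambda>x. SUP s\<in>{1..n}. \<integral>\<^sup>+y. ?h (x - y) \<partial>mu s)
      \<le> Lp_norm p m (\<lambda>x. ?S x + (\<Sum>s\<in>{1..n}. ?D s x))"
  proof (rule Lp_norm_mono)
    show "(SUP s\<in>{1..n}. \<integral>\<^sup>+y. ?h (x - y) \<partial>mu s) \<le> ?S x + (\<Sum>s\<in>{1..n}. ?D s x)" for x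
    proof (rule SUP_least)
      fix s assume s: "s \<in> {1..n}"
      have "?D s x \<le> (\<Sum>s\<in>{1..n}. ?D s x)" using s by (intro member_le_sum) auto
      then show "(\<integral>\<^sup>+y. ?h (x - y) \<partial>mu s) \<le> ?S x + (\<Sum>s\<in>{1..n}. ?D s x)"
        using s by (intro order_trans[OF bnd[OF s]] add_mono SUP_upper)
    qed
  qed (use p in simp)
  also have "\<dots> \<le> Lp_norm p m ?S + Lp_norm p m (\<lambda>x. \<Sum>s\<in>{1..n}. ?D s x)"
    using Sm Dm' by (intro Lp_norm_triangle p borel_measurable_sum) auto
  also have "\<dots> \<le> ennreal q * Lp_norm p m (\<lambda>x. ennreal (?g x)) + ennreal (real n * d)"
  proof (rule add_mono)
    show "Lp_norm p m ?S \<le> ennreal q * Lp_norm p m (\<lambda>x. ennreal (?g x))"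
      unfolding q_def by (rule maximal_inequality_continuous[where lam=lam, OF G haar lam fac n p gc]) auto
    have "Lp_norm p m (\<lambda>x. \<Sum>s\<in>{1..n}. ?D s x) \<le> (\<Sum>s\<in>{1..n}. Lp_norm p m (?D s))"
      using Dm' by (intro Lp_norm_sum p) auto
    also have "\<dots> \<le> (\<Sum>s\<in>{1..n}. ennreal d)"
    proof (rule sum_mono)
      fix s assume "s \<in> {1..n}"
      then have s1: "s \<ge> 1" by simp
      have "Lp_norm p m (?D s) \<le> Lp_norm p m ?d"
        unfolding mu[OF s1] by (rule Lp_norm_self_conv_le[OF G haar lam[OF s1] p meas(1)])
      then show "Lp_norm p m (?D s) \<le> ennreal d" using \<phi>(2) by simp
    qed
    also have "\<dots> = ennreal (real n * d)" using d by (simp add: ennreal_mult ennreal_of_nat_eq_real_of_nat)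
    finally show "Lp_norm p m (\<lambda>x. \<Sum>s\<in>{1..n}. ?D s x) \<le> ennreal (real n * d)" .
  qed
  also have "Lp_norm p m (\<lambda>x. ennreal (?g x)) \<le> Lp_norm p m ?h + ennreal d"
  proof -
    have "Lp_norm p m (\<lambda>x. ennreal (?g x)) \<le> Lp_norm p m (\<lambda>x. ?h x + ?d x)"
    proof (rule Lp_norm_mono)
      show "ennreal (?g x) \<le> ?h x + ?d x" for x
        using norm_triangle_ineq4[of "f x" "f x - \<phi> x"] by (simp flip: ennreal_plus)
    qed (use p in simp)
    also have "\<dots> \<le> Lp_norm p m ?h + Lp_norm p m ?d"
      using meas by (intro Lp_norm_triangle p) (simp_all add: sm cong: measurable_cong_sets)
    finally show ?thesis using \<phi>(2) by (auto intro: order_trans add_left_mono)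
  qed
  then have "ennreal q * Lp_norm p m (\<lambda>x. ennreal (?g x)) + ennreal (real n * d)
      \<le> ennreal q * (Lp_norm p m ?h + ennreal d) + ennreal (real n * d)"
    by (intro add_right_mono mult_left_mono) auto
  also have "\<dots> = ennreal q * Lp_norm p m ?h + ennreal e"
  proof -
    have "(q + real n) * d = e" using add_pos_nonneg[OF q, of "real n"] by (simp add: d_def)
    then have "q * d + real n * d = e" by (simp only: distrib_right)
    then have "ennreal q * ennreal d + ennreal (real n * d) = ennreal e"
      using q d by (simp flip: ennreal_mult ennreal_plus)
    then show ?thesis by (simp add: distrib_left add.assoc)
  qed
  finally show "Lp_norm p m (\<lambda>x. SUP s\<in>{1..n}. \<integral>\<^sup>+y. ?h (x - y) \<partial>mu s)
      \<le> ennreal (p / (p - 1)) * Lp_norm p m ?h + ennreal e" unfolding q_def .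
qed

text \<open>The averages of |f| are used rather than |T_s f|: they dominate the latter, and their
  finiteness almost everywhere is what makes the integrals defining T_s f exist. The finite maxima
  increase to the supremum.\<close>

lemma maximal_inequality:
  fixes f :: "'a::{topological_ab_group_add, t2_space} \<Rightarrow> complex"
  assumes G: "compact (UNIV :: 'a set)" and haar: "normalized_haar m"
    and lam: "\<And>s. s \<ge> 1 \<Longrightarrow> regular_borel_prob (lam s)"
    and fac: "\<And>s. s \<ge> 1 \<Longrightarrow> \<exists>kap. regular_borel_prob kap \<and> lam s = measure_conv (lam (s + 1)) kap"
    and mu: "\<And>s. s \<ge> (1 :: nat) \<Longrightarrow> mu s = measure_conv (lam s) (reflected (lam s))"
    and p: "p > 1" and f: "f \<in> Lp_space p m"
  shows "Lp_norm p m (\<lambda>x. SUP s\<in>{1..}. \<integral>\<^sup>+y. ennreal (norm (f (x - y))) \<partial>mu s)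
    \<le> ennreal (p / (p - 1)) * Lp_norm p m (\<lambda>x. ennreal (norm (f x)))"
proof -
  note sm = regular_borel_probD(3)[OF normalized_haarD(1)[OF haar]]
  have fb: "f \<in> borel_measurable borel"
    using Lp_spaceD(1)[OF f] by (simp add: sm cong: measurable_cong_sets)
  have h: "(\<lambda>x. ennreal (norm (f x))) \<in> borel_measurable borel" using fb by measurable
  let ?P = "\<lambda>s x. \<integral>\<^sup>+y. ennreal (norm (f (x - y))) \<partial>mu s"
  let ?F = "\<lambda>n x. SUP s\<in>{1..Suc n}. ?P s x"
  have Pm: "?P s \<in> borel_measurable m" if "s \<in> {1..Suc n}" for s n
    using nn_integral_minus_self_conv_measurable[OF lam h, of s] mu[of s] that
    by (simp add: sm cong: measurable_cong_sets)
  have "(SUP s\<in>{1..}. ?P s x) = (SUP n. ?F n x)" for x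
  proof (rule antisym)
    show "(SUP s\<in>{1..}. ?P s x) \<le> (SUP n. ?F n x)"
    proof (rule SUP_least)
      fix s :: nat assume "s \<in> {1..}"
      then have "?P s x \<le> ?F s x" by (intro SUP_upper) auto
      also have "\<dots> \<le> (SUP n. ?F n x)" by (rule SUP_upper) simp
      finally show "?P s x \<le> (SUP n. ?F n x)" .
    qed
    show "(SUP n. ?F n x) \<le> (SUP s\<in>{1..}. ?P s x)"
      by (intro SUP_least SUP_upper) auto
  qed
  then have "Lp_norm p m (\<lambda>x. SUP s\<in>{1..}. ?P s x) = Lp_norm p m (\<lambda>x. SUP n. ?F n x)" by simp
  also have "\<dots> = (SUP n. Lp_norm p m (?F n))"
  proof (rule Lp_norm_SUP)
    show "?F n \<in> borel_measurable m" for n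
      by (rule borel_measurable_SUP[OF _ Pm[where n=n]]) simp_all
    show "incseq ?F"
      unfolding incseq_def le_fun_def by (intro allI impI SUP_subset_mono) auto
  qed (use p in simp)
  also have "\<dots> \<le> ennreal (p / (p - 1)) * Lp_norm p m (\<lambda>x. ennreal (norm (f x)))"
    by (intro SUP_least maximal_inequality_finite[where lam=lam, OF G haar lam fac mu _ p f]) auto
  finally show ?thesis .
qed

section \<open>From averages of absolute values to the operators and their convergence\<close>

text \<open>This covers non-integrable functions too, whose Bochner integral is 0 by
  convention.\<close>

lemma norm_integral_le_nn_integral:
  fixes f :: "'a \<Rightarrow> complex"
  shows "ennreal (norm (\<integral>y. f y \<partial>M)) \<le> (\<integral>\<^sup>+y. ennreal (norm (f y)) \<partial>M)"
  by (cases "integrable M f") (auto intro: integral_norm_bound_ennreal simp: not_integrable_integral_eq)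

text \<open>The function (x, y) to f (x - y) may fail to be measurable for the product
  sigma-algebra. The laws of x - Y form a kernel by the result for nonnegative functions, and a
  Bochner integral against a kernel is measurable.\<close>

lemma borel_measurable_fun_conv:
  fixes N :: "'a::topological_ab_group_add measure"
  assumes N: "regular_borel_prob N" and f: "f \<in> borel_measurable borel"
  shows "fun_conv f (measure_conv N (reflected N)) \<in> borel_measurable borel"
proof -
  let ?n = "measure_conv N (reflected N)"
  have np: "?n \<in> borel_probs"
    by (rule measure_conv_borel_probs[OF regular_borel_probD(1)[OF N] regular_borel_prob_reflected[OF N]])
  interpret prob_space ?n by (rule borel_probsD(1)[OF np])
  have d: "(\<lambda>y. x - y) \<in> ?n \<rightarrow>\<^sub>M borel" for x
    using measurable_diff_const by (simp cong: measurable_cong_sets)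
  have "(\<lambda>x. distr ?n borel (\<lambda>y. x - y)) \<in> borel \<rightarrow>\<^sub>M subprob_algebra borel"
  proof (rule measurable_subprob_algebra)
    show "subprob_space (distr ?n borel (\<lambda>y. x - y))" for x
      by (intro prob_space_imp_subprob_space prob_space_distr d)
    fix A :: "'a set" assume A: "A \<in> sets borel"
    then have i: "indicator A \<in> borel_measurable (borel :: 'a measure)" by simp
    have "emeasure (distr ?n borel (\<lambda>y. x - y)) A = (\<integral>\<^sup>+y. indicator A (x - y) \<partial>?n)" for x
      using A nn_integral_distr[OF d, of "indicator A" x] by simp
    then show "(\<lambda>x. emeasure (distr ?n borel (\<lambda>y. x - y)) A) \<in> borel_measurable borel"
      using nn_integral_minus_self_conv_measurable[OF N i] by simp
  qed simp
  from measurable_compose[OF this integral_measurable_subprob_algebra[OF f]]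
  show ?thesis by (simp add: fun_conv_def[abs_def] integral_distr[OF d f])
qed

lemma Lp_norm_finite_AE:
  assumes p: "p > 0" and [measurable]: "F \<in> borel_measurable M" and fin: "Lp_norm p M F < \<infinity>"
  shows "AE x in M. F x < \<infinity>"
proof -
  have "(\<integral>\<^sup>+x. enn_powr (F x) p \<partial>M) \<noteq> \<infinity>"
    using fin unfolding Lp_norm_def enn_powr_less_top_iff by simp
  then have "AE x in M. enn_powr (F x) p \<noteq> \<infinity>" by (intro nn_integral_PInf_AE) auto
  then show ?thesis
  proof eventually_elim
    case (elim x)
    then show ?case using enn_powr_less_top_iff[of "F x" p] by (simp add: less_top)
  qed
qed

theorem theorem3p6:
  fixes m :: "'a::{topological_ab_group_add, t2_space} measure"
    and lam mu :: "nat \<Rightarrow> 'a measure"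
  assumes compact: "compact (UNIV :: 'a set)"
    and haar: "normalized_haar m"
    and lam: "\<And>s. s \<ge> 1 \<Longrightarrow> regular_borel_prob (lam s)"
    and lam_factor: "\<And>s. s \<ge> 1 \<Longrightarrow>
      \<exists>kap. regular_borel_prob kap \<and> lam s = measure_conv (lam (s + 1)) kap"
    and mu: "\<And>s. s \<ge> 1 \<Longrightarrow> mu s = measure_conv (lam s) (reflected (lam s))"
  shows "(\<forall>p > 1. \<forall>f \<in> Lp_space p m.
            (\<forall>s \<ge> 1. (AE x in m. integrable (mu s) (\<lambda>y. f (x - y))) \<and>
                     fun_conv f (mu s) \<in> Lp_space p m) \<and>
            Lp_norm p m (\<lambda>x. SUP s\<in>{1..}. ennreal (norm (fun_conv f (mu s) x)))
              \<le> ennreal (p / (p - 1)) * Lp_norm p m (\<lambda>x. ennreal (norm (f x)))) \<and>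
         (weak_star_to_delta0 mu \<longrightarrow>
          (\<forall>p > 1. \<forall>f \<in> Lp_space p m.
            (AE x in m. (\<lambda>s. fun_conv f (mu s) x) \<longlonglongrightarrow> f x) \<and>
            (\<lambda>s. Lp_norm p m (\<lambda>x. ennreal (norm (fun_conv f (mu s) x - f x)))) \<longlonglongrightarrow> 0))"
proof -
  note mr = normalized_haarD(1)[OF haar]
  note sm = regular_borel_probD(3)[OF mr]
  have mp: "mu s \<in> borel_probs" if "s \<ge> 1" for s
    unfolding mu[OF that]
    by (rule measure_conv_borel_probs[OF regular_borel_probD(1)[OF lam[OF that]] regular_borel_prob_reflected[OF lam[OF that]]])
  let ?P = "\<lambda>s f x. \<integral>\<^sup>+y. ennreal (norm (f (x - y) :: complex)) \<partial>mu s"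
  let ?M = "\<lambda>f x. SUP s\<in>{1..}. ?P s f x"
  have toborel: "h \<in> borel_measurable borel" if "h \<in> borel_measurable m" for h :: "'a \<Rightarrow> complex"
    using that by (simp add: sm cong: measurable_cong_sets)
  have Pm: "?P s f \<in> borel_measurable m" if f: "f \<in> borel_measurable borel" and s: "s \<ge> 1" for f s
  proof -
    have "(\<lambda>x. ennreal (norm (f x))) \<in> borel_measurable borel" using f by measurable
    from nn_integral_minus_self_conv_measurable[OF lam[OF s] this] show ?thesis
      by (simp add: mu[OF s] sm cong: measurable_cong_sets)
  qed
  have Mm: "?M f \<in> borel_measurable m" if f: "f \<in> borel_measurable borel" for f
    by (rule borel_measurable_SUP[OF _ Pm[OF f]]) simp_all
  have Tm: "fun_conv f (mu s) \<in> borel_measurable m" if f: "f \<in> borel_measurable borel" and s: "s \<ge> 1" for f s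
    using borel_measurable_fun_conv[OF lam[OF s] f] by (simp add: mu[OF s] sm cong: measurable_cong_sets)
  have TP: "ennreal (norm (fun_conv f (mu s) x)) \<le> ?P s f x" for f s x
    unfolding fun_conv_def by (rule norm_integral_le_nn_integral)
  have TM: "ennreal (norm (fun_conv f (mu s) x)) \<le> ?M f x" if "s \<ge> 1" for f s x
    using that by (intro order_trans[OF TP] SUP_upper) auto
  have max: "Lp_norm p m (?M f) \<le> ennreal (p / (p - 1)) * Lp_norm p m (\<lambda>x. ennreal (norm (f x)))"
    if "p > 1" "f \<in> Lp_space p m" for p f
    by (rule maximal_inequality[where lam=lam, OF compact haar lam lam_factor mu that])
  have fin: "Lp_norm p m (?M f) < \<infinity>" if p: "p > 1" and f: "f \<in> Lp_space p m" for p f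
    using max[OF p f] Lp_spaceD(2)[OF f]
    by (auto simp: ennreal_mult_less_top intro: le_less_trans)
  \<comment> \<open>One null set serves all \<open>s\<close>, because the maximal function of |f| is
    finite off it.\<close>
  have int: "AE x in m. \<forall>s\<ge>1. integrable (mu s) (\<lambda>y. f (x - y))" if p: "p > 1" and f: "f \<in> Lp_space p m" for p f
  proof -
    have fb: "f \<in> borel_measurable borel" by (rule toborel[OF Lp_spaceD(1)[OF f]])
    have "AE x in m. ?M f x < \<infinity>"
      using p by (intro Lp_norm_finite_AE[OF _ Mm[OF fb] fin[OF p f]]) simp
    then show ?thesis
    proof eventually_elim
      case (elim x)
      show ?case
      proof (intro allI impI)
        fix s :: nat assume s: "s \<ge> 1"
        have "?P s f x \<le> ?M f x" using s by (intro SUP_upper) auto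
        then have "?P s f x < \<infinity>" using elim by (rule le_less_trans)
        moreover have "(\<lambda>y. f (x - y)) \<in> borel_measurable (mu s)"
          using measurable_compose[OF measurable_diff_const fb]
          by (simp add: borel_probsD(2)[OF mp[OF s]] cong: measurable_cong_sets)
        ultimately show "integrable (mu s) (\<lambda>y. f (x - y))" by (intro integrableI_bounded)
      qed
    qed
  qed
  have part1: "(\<forall>s \<ge> 1. (AE x in m. integrable (mu s) (\<lambda>y. f (x - y))) \<and> fun_conv f (mu s) \<in> Lp_space p m) \<and>
      Lp_norm p m (\<lambda>x. SUP s\<in>{1..}. ennreal (norm (fun_conv f (mu s) x)))
        \<le> ennreal (p / (p - 1)) * Lp_norm p m (\<lambda>x. ennreal (norm (f x)))"
    if p: "p > 1" and f: "f \<in> Lp_space p m" for p f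
  proof (intro conjI allI impI)
    have fb: "f \<in> borel_measurable borel" by (rule toborel[OF Lp_spaceD(1)[OF f]])
    fix s :: nat assume s: "s \<ge> 1"
    show "AE x in m. integrable (mu s) (\<lambda>y. f (x - y))"
      using int[OF p f] by eventually_elim (use s in auto)
    have "Lp_norm p m (\<lambda>x. ennreal (norm (fun_conv f (mu s) x))) \<le> Lp_norm p m (?M f)"
      using p by (intro Lp_norm_mono TM s) auto
    then show "fun_conv f (mu s) \<in> Lp_space p m"
      using fin[OF p f] Tm[OF fb s] by (auto simp: Lp_space_def intro: le_less_trans)
  next
    have "Lp_norm p m (\<lambda>x. SUP s\<in>{1..}. ennreal (norm (fun_conv f (mu s) x))) \<le> Lp_norm p m (?M f)"
      using p TP by (intro Lp_norm_mono SUP_mono') auto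
    then show "Lp_norm p m (\<lambda>x. SUP s\<in>{1..}. ennreal (norm (fun_conv f (mu s) x)))
        \<le> ennreal (p / (p - 1)) * Lp_norm p m (\<lambda>x. ennreal (norm (f x)))"
      using max[OF p f] by (rule order_trans)
  qed
  have part2: "(AE x in m. (\<lambda>s. fun_conv f (mu s) x) \<longlonglongrightarrow> f x) \<and>
      (\<lambda>s. Lp_norm p m (\<lambda>x. ennreal (norm (fun_conv f (mu s) x - f x)))) \<longlonglongrightarrow> 0"
    if weak: "weak_star_to_delta0 mu" and p: "p > 1" and f: "f \<in> Lp_space p m" for p f
  proof
    have fb: "f \<in> borel_measurable borel" by (rule toborel[OF Lp_spaceD(1)[OF f]])
    have "\<forall>n :: nat. \<exists>\<phi>. continuous_on UNIV \<phi> \<and> Lp_norm p m (\<lambda>x. ennreal (norm (f x - \<phi> x))) \<le> ennreal (1 / Suc n)"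
      by (intro allI Lp_dense_continuous[OF compact mr p f]) simp
    from choice[OF this] obtain \<phi> where \<phi>: "\<And>n :: nat. continuous_on UNIV (\<phi> n)"
      "\<And>n. Lp_norm p m (\<lambda>x. ennreal (norm (f x - \<phi> n x))) \<le> ennreal (1 / Suc n)" by auto
    define g where "g n x = f x - \<phi> n x" for n x
    have gb: "g n \<in> borel_measurable borel" for n
      unfolding g_def using fb borel_measurable_continuous_onI[OF \<phi>(1)[of n]] by measurable
    have gn: "Lp_norm p m (\<lambda>x. ennreal (norm (g n x))) \<le> ennreal (1 / Suc n)" for n
      using \<phi>(2)[of n] by (simp add: g_def)
    have gL: "g n \<in> Lp_space p m" for n
      using gb[of n] gn[of n] by (auto simp: Lp_space_def sm intro: le_less_trans cong: measurable_cong_sets)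
    \<comment> \<open>A bound for |T_s (g n) - g n| that is uniform in s >= 1.\<close>
    define D where "D n x = ?M (g n) x + ennreal (norm (g n x))" for n x
    have gm: "(\<lambda>x. ennreal (norm (g n x))) \<in> borel_measurable m" for n
      using Lp_spaceD(1)[OF gL[of n]] by measurable
    have Dm: "D n \<in> borel_measurable m" for n
      unfolding D_def using Mm[OF gb[of n]] gm[of n] by measurable
    define q where "q = p / (p - 1) + 1"
    have q: "p / (p - 1) > 0" "q > 0" using p by (auto simp: q_def add_pos_pos)
    have Dn: "Lp_norm p m (D n) \<le> ennreal (q / Suc n)" for n
    proof -
      have "Lp_norm p m (D n) \<le> Lp_norm p m (?M (g n)) + Lp_norm p m (\<lambda>x. ennreal (norm (g n x)))"
        unfolding D_def by (rule Lp_norm_triangle[OF p Mm[OF gb] gm])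
      also have "\<dots> \<le> ennreal (p / (p - 1)) * ennreal (1 / Suc n) + ennreal (1 / Suc n)"
        by (intro add_mono gn order_trans[OF max[OF p gL]] mult_left_mono) auto
      also have "\<dots> = ennreal (p / (p - 1) * (1 / Suc n) + 1 / Suc n)"
      proof -
        have *: "ennreal a * ennreal b + ennreal b = ennreal (a * b + b)" if "a \<ge> 0" "b \<ge> 0" for a b
          using that by (simp add: ennreal_mult ennreal_plus)
        show ?thesis by (rule *) (use q(1) in auto)
      qed
      also have "p / (p - 1) * (1 / Suc n) + 1 / Suc n = q / Suc n"
        by (simp add: q_def add_divide_distrib)
      finally show ?thesis .
    qed
    \<comment> \<open>The infimum lies below every \<open>D n\<close>, whose norms tend to 0. So at
      almost every x some \<open>D n x\<close> is as small as desired, with n depending on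
      x.\<close>
    have "Lp_norm p m (\<lambda>x. INF n. D n x) = 0"
    proof -
      have "Lp_norm p m (\<lambda>x. INF n. D n x) \<le> ennreal (q / Suc n)" for n
        using p by (intro order_trans[OF Lp_norm_mono Dn[of n]] INF_lower) auto
      moreover have "(\<lambda>n. ennreal (q / Suc n)) \<longlonglongrightarrow> ennreal 0"
        by (intro tendsto_ennrealI LIMSEQ_Suc[OF lim_const_over_n])
      ultimately have "Lp_norm p m (\<lambda>x. INF n. D n x) \<le> ennreal 0"
        by (intro LIMSEQ_le_const) auto
      then show ?thesis by simp
    qed
    then have "(\<integral>\<^sup>+x. enn_powr (INF n. D n x) p \<partial>m) = 0"
      by (simp add: Lp_norm_def enn_powr_eq_0_iff)
    moreover have "(\<lambda>x. enn_powr (INF n. D n x) p) \<in> borel_measurable m"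
      using Dm by (intro measurable_compose[OF borel_measurable_INF measurable_enn_powr]) auto
    ultimately have "AE x in m. (INF n. D n x) = 0"
      by (simp add: nn_integral_0_iff_AE enn_powr_eq_0_iff)
    with int[OF p f] show conv: "AE x in m. (\<lambda>s. fun_conv f (mu s) x) \<longlonglongrightarrow> f x"
    proof eventually_elim
      case (elim x)
      show ?case
      proof (rule tendstoI)
        fix e :: real assume e: "e > 0"
        have "(INF n. D n x) < ennreal (e / 2)" using elim(2) e by simp
        then obtain n where n: "D n x < ennreal (e / 2)" by (auto simp: INF_less_iff)
        have c: "continuous_on UNIV (\<lambda>y. \<phi> n (x - y))"
          by (rule continuous_on_compose2[OF \<phi>(1)]) (auto intro!: continuous_intros)
        have "(\<lambda>s. fun_conv (\<phi> n) (mu s) x) \<longlonglongrightarrow> \<phi> n (x - 0)"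
          using weak c unfolding weak_star_to_delta0_def fun_conv_def by blast
        then have "\<forall>\<^sub>F s in sequentially. dist (fun_conv (\<phi> n) (mu s) x) (\<phi> n x) < e / 2"
          using e by (intro tendstoD) auto
        then show "\<forall>\<^sub>F s in sequentially. dist (fun_conv f (mu s) x) (f x) < e"
          using eventually_ge_at_top[of 1]
        proof eventually_elim
          case (elim s)
          have "integrable (mu s) (\<lambda>y. \<phi> n (x - y))"
            by (rule integrable_continuous_compact[OF compact mp[OF elim(2)] c])
          \<comment> \<open>Linearity of the Bochner integral requires both parts to be integrable
            at this very x, which is the use of \<open>int\<close>.\<close>
          then have "fun_conv (g n) (mu s) x = fun_conv f (mu s) x - fun_conv (\<phi> n) (mu s) x"
            using \<open>\<forall>s\<ge>1. integrable (mu s) (\<lambda>y. f (x - y))\<close> elim(2)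
            by (simp add: fun_conv_def g_def)
          then have "fun_conv f (mu s) x - f x
              = fun_conv (g n) (mu s) x - g n x + (fun_conv (\<phi> n) (mu s) x - \<phi> n x)"
            by (simp add: g_def)
          then have "norm (fun_conv f (mu s) x - f x)
              \<le> norm (fun_conv (g n) (mu s) x) + norm (g n x) + norm (fun_conv (\<phi> n) (mu s) x - \<phi> n x)"
            by (smt (verit) norm_triangle_ineq norm_triangle_ineq4)
          moreover have "norm (fun_conv (g n) (mu s) x) + norm (g n x) < e / 2"
          proof -
            have "ennreal (norm (fun_conv (g n) (mu s) x) + norm (g n x)) \<le> D n x"
              using TM[OF elim(2), of "g n" x] by (simp add: D_def ennreal_plus add_right_mono)
            then have "ennreal (norm (fun_conv (g n) (mu s) x) + norm (g n x)) < ennreal (e / 2)"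
              using n by (rule le_less_trans)
            then show ?thesis by (subst (asm) ennreal_less_iff) auto
          qed
          ultimately show ?case using elim(1) by (simp add: dist_norm)
        qed
      qed
    qed
    \<comment> \<open>The measure at index 0 is arbitrary, so dominated convergence is applied to
      the shifted sequence, with the maximal function of |f| plus |f| as majorant.\<close>
    have "(\<lambda>s. Lp_norm p m (\<lambda>x. ennreal (norm (fun_conv f (mu (Suc s)) x - f x)))) \<longlonglongrightarrow> 0"
    proof (rule Lp_norm_dominated_tendsto_0[where W="\<lambda>x. ?M f x + ennreal (norm (f x))"])
      have hm: "(\<lambda>x. ennreal (norm (f x))) \<in> borel_measurable m"
        using Lp_spaceD(1)[OF f] by measurable
      show "(\<lambda>x. ?M f x + ennreal (norm (f x))) \<in> borel_measurable m"
        by (rule borel_measurable_add[OF Mm[OF fb] hm])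
      show "(\<lambda>x. ennreal (norm (fun_conv f (mu (Suc s)) x - f x))) \<in> borel_measurable m" for s
        by (intro borel_measurable_norm_diff Tm[OF fb] Lp_spaceD(1)[OF f]) simp
      show "AE x in m. ennreal (norm (fun_conv f (mu (Suc s)) x - f x)) \<le> ?M f x + ennreal (norm (f x))" for s
      proof (rule AE_I2)
        fix x
        have "ennreal (norm (fun_conv f (mu (Suc s)) x - f x))
            \<le> ennreal (norm (fun_conv f (mu (Suc s)) x) + norm (f x))"
          by (intro ennreal_leI norm_triangle_ineq4)
        also have "\<dots> \<le> ?M f x + ennreal (norm (f x))"
          using TM[of "Suc s" f x] by (simp add: ennreal_plus add_right_mono)
        finally show "ennreal (norm (fun_conv f (mu (Suc s)) x - f x)) \<le> ?M f x + ennreal (norm (f x))" .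
      qed
      have "Lp_norm p m (\<lambda>x. ?M f x + ennreal (norm (f x))) \<le> Lp_norm p m (?M f) + Lp_norm p m (\<lambda>x. ennreal (norm (f x)))"
        by (rule Lp_norm_triangle[OF p Mm[OF fb] hm])
      also have "\<dots> < \<infinity>" using fin[OF p f] Lp_spaceD(2)[OF f] by simp
      finally show "Lp_norm p m (\<lambda>x. ?M f x + ennreal (norm (f x))) < \<infinity>" .
      show "AE x in m. (\<lambda>s. ennreal (norm (fun_conv f (mu (Suc s)) x - f x))) \<longlonglongrightarrow> 0"
        using conv
      proof eventually_elim
        case (elim x)
        have "(\<lambda>s. norm (fun_conv f (mu (Suc s)) x - f x)) \<longlonglongrightarrow> 0"
          using LIMSEQ_Suc[OF elim] by (intro tendsto_norm_zero) (simp add: LIM_zero)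
        from tendsto_ennrealI[OF this] show ?case by simp
      qed
    qed (use p in simp)
    then show "(\<lambda>s. Lp_norm p m (\<lambda>x. ennreal (norm (fun_conv f (mu s) x - f x)))) \<longlonglongrightarrow> 0"
      by (rule LIMSEQ_imp_Suc)
  qed
  show ?thesis using part1 part2 by blast
qed

end
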